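(* Let $n\ge 4$. For every $\alpha\neq0$ in the discrete spectrum $D_n$ and every irreducible $*$-representation $\pi\in\mathrm{Rep}\,\mathcal P_{n,\alpha}$, the system of $n+1$ subspaces $S_{F(\pi)}$ is transitive; and the systems $S_{F(\pi)}$ arising from inequivalent representations are nonisomorphic, i.e. if $\alpha,\alpha'\in D_n\setminus\{0\}$ and $\pi\in\mathrm{Rep}\,\mathcal P_{n,\alpha}$, $\pi'\in\mathrm{Rep}\,\mathcal P_{n,\alpha'}$ are irreducible and not unitarily equivalent, then $S_{F(\pi)}\not\cong S_{F(\pi')}$.
   Context: Hilbert spaces are complex and nonzero; $B(H)$ denotes the bounded linear operators on $H$. A system of $m$ subspaces $S=(H;H_1,\dots,H_m)$ consists of a Hilbert space $H$ and $m$ (closed) subspaces of it. Systems $S=(H;H_1,\dots,H_m)$ and $\tilde S=(\tilde H;\tilde H_1,\dots,\tilde H_m)$ are isomorphic, $S\cong\tilde S$, if there is a bounded linear bijection $R:H\to\tilde H$ with $R(H_i)=\tilde H_i$ for all $i$. Put $\mathrm{End}(S)=\{R\in B(H) : R(H_i)\subset H_i,\ i=1,\dots,m\}$; $S$ is transitive if $\mathrm{End}(S)=\mathbb C I_H$. For real $\alpha\ge 0$, $\mathcal P_{n,\alpha}=\mathbb C\langle p_1,\dots,p_n \mid p_1+\dots+p_n=\alpha e,\ p_j^2=p_j=p_j^*,\ j=1,\dots,n\rangle$ is a unital $*$-algebra with unit $e$. $\mathrm{Rep}\,\mathcal P_{n,\alpha}$ denotes its unital $*$-representations by bounded operators on Hilbert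 spaces; such a $\pi$ on $H$ is the same thing as orthogonal projections $P_i=\pi(p_i)$ on $H$ with $\sum_{i=1}^nP_i=\alpha I_H$. It is irreducible if the only closed subspaces of $H$ invariant under all $P_i$ are $\{0\}$ and $H$. Representations $\pi$ on $H$ and $\pi'$ on $H'$ are unitarily equivalent if there is a unitary $W:H\to H'$ with $W\pi(p_i)=\pi'(p_i)W$ for all $i$ (this makes sense also for representations of $\mathcal P_{n,\alpha}$ and $\mathcal P_{n,\alpha'}$ with $\alpha\neq\alpha'$). For $\tau\in\mathbb R$, $\mathcal P_{n,\mathrm{abo},\tau}=\mathbb C\langle q_1,\dots,q_n,p\mid q_1+\dots+q_n=e,\ q_jpq_j=\tau q_j,\ q_j^2=q_j=q_j^*\ (j=1,\dots,n),\ p^2=p=p^*\rangle$. The map $F:\mathrm{Rep}\,\mathcal P_{n,\alpha}\to\mathrm{Rep}\,\mathcal P_{n,\mathrm{abo},1/\alpha}$, $\alpha\ne0$, is defined as follows. Given $\pi$ on $H$ with $P_i=\pi(p_i)$, let $H_i=\operatorname{Im}P_i$, let $\Gamma_i:H_i\to H$ be the inclusion isometries, $\mathcal H=H_1\oplus\dots\oplus H_n$, and $\Gamma=(\Gamma_1\ \Gamma_2\ \dots\ \Gamma_n):\mathcal H\to H$. Let $Q_i=\mathrm{diag}(0,\dots,0,I_{H_i},0,\dots,0)$ be the orthogonal projection of $\mathcal H$ onto the $i$-th summand and let $P=\frac1\alpha\Gamma^*\Gamma$, i.e. the orthogonal projection on $\mathcal H$ with block matrix $\frac1\alpha\|\Gamma_i^*\Gamma_j\|_{i,j=1}^n$.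 Then $F(\pi)$ is the representation on $\mathcal H$ with $q_i\mapsto Q_i$, $p\mapsto P$, and the associated system of $n+1$ subspaces is $S_{F(\pi)}=(\mathcal H;Q_1\mathcal H,\dots,Q_n\mathcal H,P\mathcal H)$. Discrete spectrum: for $n\ge4$ let $$\Lambda_n^0=\Big\{0,\ 1+\tfrac1{n-1},\ 1+\tfrac1{(n-2)-\frac1{n-1}},\ \dots,\ 1+\tfrac{1}{(n-2)-\frac{1}{(n-2)-\frac{1}{\ddots-\frac1{n-1}}}},\dots\Big\},$$ $$\Lambda_n^1=\Big\{1,\ 1+\tfrac1{n-2},\ 1+\tfrac1{(n-2)-\frac1{n-2}},\ \dots,\ 1+\tfrac{1}{(n-2)-\frac{1}{(n-2)-\frac{1}{\ddots-\frac1{n-2}}}},\dots\Big\};$$ equivalently, $\Lambda_n^0$ and $\Lambda_n^1$ are the forward orbits of $0$ and of $1$, respectively, under the map $x\mapsto 1+\frac1{n-1-x}$. The discrete spectrum is $D_n=\Lambda_n^0\cup\Lambda_n^1\cup(n-\Lambda_n^1)\cup(n-\Lambda_n^0)$, where $n-\Lambda=\{n-x: x\in\Lambda\}$. *)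

theory Defs
  imports "HOL-Analysis.Analysis"
begin

section \<open>Complex Hilbert spaces\<close>

text \<open>The inner product is linear in its first argument.\<close>

class chilbert_space = banach +
  fixes scaleC :: "complex \<Rightarrow> 'a \<Rightarrow> 'a" (infixr "*\<^sub>C" 75)
    and cinner :: "'a \<Rightarrow> 'a \<Rightarrow> complex"
  assumes scaleC_add_right: "c *\<^sub>C (x + y) = c *\<^sub>C x + c *\<^sub>C y"
    and scaleC_add_left: "(c + d) *\<^sub>C x = c *\<^sub>C x + d *\<^sub>C x"
    and scaleC_scaleC: "c *\<^sub>C d *\<^sub>C x = (c * d) *\<^sub>C x"
    and scaleC_of_real: "complex_of_real r *\<^sub>C x = r *\<^sub>R x"
    and cinner_commute: "cinner x y = cnj (cinner y x)"
    and cinner_add_left: "cinner (x + y) z = cinner x z + cinner y z"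
    and cinner_scaleC_left: "cinner (c *\<^sub>C x) y = c * cinner x y"
    and cinner_self: "cinner x x = complex_of_real ((norm x)\<^sup>2)"

lemma scaleC_one [simp]: "1 *\<^sub>C x = (x :: 'a::chilbert_space)"
  using scaleC_of_real[of 1 x] by simp

lemma scaleC_zero_right [simp]: "c *\<^sub>C 0 = (0 :: 'a::chilbert_space)"
  using scaleC_add_right[of c 0 0] by simp

lemma cinner_zero_left [simp]: "cinner 0 y = 0"
  using cinner_add_left[of 0 0 y] by simp

lemma cinner_add_right: "cinner x (y + z) = cinner x y + cinner x z"
  by (metis cinner_add_left cinner_commute complex_cnj_add)

lemma cinner_scaleC_right: "cinner x (c *\<^sub>C y) = cnj c * cinner x y"
  by (metis cinner_commute cinner_scaleC_left complex_cnj_mult)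

lemma cinner_minus_left: "cinner (- x) y = - cinner x y"
  using cinner_add_left[of "- x" x y] by (simp add: eq_neg_iff_add_eq_0)

lemma cinner_diff_left: "cinner (x - y) z = cinner x z - cinner y z"
  using cinner_add_left[of x "- y" z] cinner_minus_left[of y z] by simp

lemma cinner_diff_right: "cinner x (y - z) = cinner x y - cinner x z"
  by (metis cinner_diff_left cinner_commute complex_cnj_diff)

lemma cinner_zero_right [simp]: "cinner x 0 = 0"
  by (metis cinner_commute cinner_zero_left complex_cnj_zero)

lemma cinner_sum_left: "cinner (\<Sum>i\<in>A. f i) y = (\<Sum>i\<in>A. cinner (f i) y)"
  by (induction A rule: infinite_finite_induct) (simp_all add: cinner_add_left)

lemma cinner_sum_right: "cinner x (\<Sum>i\<in>A. f i) = (\<Sum>i\<in>A. cinner x (f i))"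
  by (induction A rule: infinite_finite_induct) (simp_all add: cinner_add_right)

lemma scaleC_sum_right: "c *\<^sub>C (\<Sum>i\<in>A. f i) = (\<Sum>i\<in>A. c *\<^sub>C f i)"
  by (induction A rule: infinite_finite_induct) (simp_all add: scaleC_add_right)

lemma cinner_self_eq_0: "cinner x x = 0 \<longleftrightarrow> x = 0"
  by (simp add: cinner_self)

instantiation complex :: chilbert_space
begin

definition "c *\<^sub>C (x :: complex) = c * x"
definition "cinner (x :: complex) y = x * cnj y"

instance
  by standard
    (auto simp: scaleC_complex_def cinner_complex_def algebra_simps scaleR_conv_of_real
      complex_norm_square [symmetric])

end

text \<open>The norm of \<^typ>\<open>'a ^ 'n\<close> is the \<open>\<ell>\<^sup>2\<close> norm, so this is the
  Hilbert space sum of copies of \<^typ>\<open>'a\<close> indexed by \<^typ>\<open>'n\<close>.\<close>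

instantiation vec :: (chilbert_space, finite) chilbert_space
begin

definition "c *\<^sub>C (x :: 'a ^ 'b) = (\<chi> i. c *\<^sub>C (x $ i))"
definition "cinner (x :: 'a ^ 'b) y = (\<Sum>i\<in>UNIV. cinner (x $ i) (y $ i))"

instance
proof
  fix x y z :: "'a ^ 'b" and c d :: complex and r :: real
  show "c *\<^sub>C (x + y) = c *\<^sub>C x + c *\<^sub>C y"
    by (simp add: scaleC_vec_def vec_eq_iff scaleC_add_right)
  show "(c + d) *\<^sub>C x = c *\<^sub>C x + d *\<^sub>C x"
    by (simp add: scaleC_vec_def vec_eq_iff scaleC_add_left)
  show "c *\<^sub>C d *\<^sub>C x = (c * d) *\<^sub>C x"
    by (simp add: scaleC_vec_def vec_eq_iff scaleC_scaleC)
  show "complex_of_real r *\<^sub>C x = r *\<^sub>R x"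
    by (simp add: scaleC_vec_def vec_eq_iff scaleC_of_real)
  show "cinner x y = cnj (cinner y x)"
    by (simp add: cinner_vec_def cinner_commute [symmetric])
  show "cinner (x + y) z = cinner x z + cinner y z"
    by (simp add: cinner_vec_def cinner_add_left sum.distrib)
  show "cinner (c *\<^sub>C x) y = c * cinner x y"
    by (simp add: cinner_vec_def scaleC_vec_def cinner_scaleC_left sum_distrib_left)
  show "cinner x x = complex_of_real ((norm x)\<^sup>2)"
    by (simp add: cinner_vec_def cinner_self norm_vec_def L2_set_def sum_nonneg)
qed

end

text \<open>Hilbert spaces are represented by nonzero closed complex subspaces \<open>H\<close> of a type of
  class \<^class>\<open>chilbert_space\<close>, the whole type included.  Operators between such spaces are
  extensional functions, so that equality of operators is equality of functions.\<close>

definition csubspace :: "'a::chilbert_space set \<Rightarrow> bool" where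
  "csubspace M \<longleftrightarrow> 0 \<in> M \<and> (\<forall>x\<in>M. \<forall>y\<in>M. x + y \<in> M) \<and> (\<forall>c. \<forall>x\<in>M. c *\<^sub>C x \<in> M)"

definition closed_csubspace :: "'a::chilbert_space set \<Rightarrow> bool" where
  "closed_csubspace M \<longleftrightarrow> csubspace M \<and> closed M"

definition hilbert :: "'a::chilbert_space set \<Rightarrow> bool" where
  "hilbert H \<longleftrightarrow> closed_csubspace H \<and> H \<noteq> {0}"

definition bounded_ops ::
    "'a::chilbert_space set \<Rightarrow> 'b::chilbert_space set \<Rightarrow> ('a \<Rightarrow> 'b) set" where
  "bounded_ops H K = {T \<in> H \<rightarrow>\<^sub>E K.
     (\<forall>x\<in>H. \<forall>y\<in>H. T (x + y) = T x + T y) \<and>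
     (\<forall>c. \<forall>x\<in>H. T (c *\<^sub>C x) = c *\<^sub>C T x) \<and>
     (\<exists>C. \<forall>x\<in>H. norm (T x) \<le> C * norm x)}"

definition is_adjoint :: "'a::chilbert_space set \<Rightarrow> 'b::chilbert_space set \<Rightarrow>
    ('a \<Rightarrow> 'b) \<Rightarrow> ('b \<Rightarrow> 'a) \<Rightarrow> bool" where
  "is_adjoint H K T T' \<longleftrightarrow>
     T' \<in> bounded_ops K H \<and> (\<forall>x\<in>H. \<forall>y\<in>K. cinner (T x) y = cinner x (T' y))"

definition adj :: "'a::chilbert_space set \<Rightarrow> 'b::chilbert_space set \<Rightarrow>
    ('a \<Rightarrow> 'b) \<Rightarrow> ('b \<Rightarrow> 'a)" where
  "adj H K T = (THE T'. is_adjoint H K T T')"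

definition orth_projection :: "'a::chilbert_space set \<Rightarrow> ('a \<Rightarrow> 'a) \<Rightarrow> bool" where
  "orth_projection H p \<longleftrightarrow>
     p \<in> bounded_ops H H \<and> (\<forall>x\<in>H. p (p x) = p x) \<and> is_adjoint H H p p"

definition unitary_op ::
    "'a::chilbert_space set \<Rightarrow> 'b::chilbert_space set \<Rightarrow> ('a \<Rightarrow> 'b) \<Rightarrow> bool" where
  "unitary_op H K W \<longleftrightarrow> W \<in> bounded_ops H K \<and> W ` H = K \<and>
     (\<forall>x\<in>H. \<forall>y\<in>H. cinner (W x) (W y) = cinner x y)"


section \<open>Systems of subspaces\<close>

record ('a, 'm) subspace_system =
  whole :: "'a set"
  sub :: "'m \<Rightarrow> 'a set"

definition is_subspace_system :: "('a::chilbert_space, 'm) subspace_system \<Rightarrow> bool" where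
  "is_subspace_system S \<longleftrightarrow>
     hilbert (whole S) \<and> (\<forall>i. closed_csubspace (sub S i) \<and> sub S i \<subseteq> whole S)"

definition isomorphic_systems :: "('a::chilbert_space, 'm) subspace_system \<Rightarrow>
    ('b::chilbert_space, 'm) subspace_system \<Rightarrow> bool" (infix "\<cong>\<^sub>S" 50) where
  "S \<cong>\<^sub>S S' \<longleftrightarrow> (\<exists>R. R \<in> bounded_ops (whole S) (whole S') \<and>
     bij_betw R (whole S) (whole S') \<and> (\<forall>i. R ` sub S i = sub S' i))"

definition End :: "('a::chilbert_space, 'm) subspace_system \<Rightarrow> ('a \<Rightarrow> 'a) set" where
  "End S = {R \<in> bounded_ops (whole S) (whole S). \<forall>i. R ` sub S i \<subseteq> sub S i}"

definition transitive_system :: "('a::chilbert_space, 'm) subspace_system \<Rightarrow> bool" where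
  "transitive_system S \<longleftrightarrow> End S = range (\<lambda>c. \<lambda>x\<in>whole S. c *\<^sub>C x)"


section \<open>Representations\<close>

text \<open>The generators are indexed by a finite type \<^typ>\<open>'n\<close> with \<open>n = CARD('n)\<close>.\<close>

definition is_rep :: "real \<Rightarrow> 'a::chilbert_space set \<Rightarrow> ('n::finite \<Rightarrow> 'a \<Rightarrow> 'a) \<Rightarrow> bool" where
  "is_rep \<alpha> H P \<longleftrightarrow> hilbert H \<and> (\<forall>i. orth_projection H (P i)) \<and>
     (\<forall>x\<in>H. (\<Sum>i\<in>UNIV. P i x) = \<alpha> *\<^sub>R x)"

definition is_rep_abo :: "real \<Rightarrow> 'a::chilbert_space set \<Rightarrow> ('n::finite \<Rightarrow> 'a \<Rightarrow> 'a) \<Rightarrow>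
    ('a \<Rightarrow> 'a) \<Rightarrow> bool" where
  "is_rep_abo \<tau> H Q p \<longleftrightarrow> hilbert H \<and> (\<forall>i. orth_projection H (Q i)) \<and> orth_projection H p \<and>
     (\<forall>x\<in>H. (\<Sum>i\<in>UNIV. Q i x) = x) \<and> (\<forall>j. \<forall>x\<in>H. Q j (p (Q j x)) = \<tau> *\<^sub>R Q j x)"

definition irreducible_rep ::
    "'a::chilbert_space set \<Rightarrow> ('n \<Rightarrow> 'a \<Rightarrow> 'a) \<Rightarrow> bool" where
  "irreducible_rep H P \<longleftrightarrow>
     (\<forall>M. closed_csubspace M \<and> M \<subseteq> H \<and> (\<forall>i. P i ` M \<subseteq> M) \<longrightarrow> M = {0} \<or> M = H)"

definition unitarily_equivalent :: "'a::chilbert_space set \<Rightarrow> ('n \<Rightarrow> 'a \<Rightarrow> 'a) \<Rightarrow>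
    'b::chilbert_space set \<Rightarrow> ('n \<Rightarrow> 'b \<Rightarrow> 'b) \<Rightarrow> bool" where
  "unitarily_equivalent H P H' P' \<longleftrightarrow>
     (\<exists>W. unitary_op H H' W \<and> (\<forall>i. \<forall>x\<in>H. W (P i x) = P' i (W x)))"


section \<open>The map \<open>F\<close>\<close>

definition F_space :: "'a::chilbert_space set \<Rightarrow> ('n::finite \<Rightarrow> 'a \<Rightarrow> 'a) \<Rightarrow> ('a ^ 'n) set" where
  "F_space H P = {x. \<forall>i. x $ i \<in> P i ` H}"

text \<open>\<open>\<Gamma> = (\<Gamma>\<^sub>1 \<dots> \<Gamma>\<^sub>n)\<close> with \<open>\<Gamma>\<^sub>i\<close> the inclusion of \<open>P i ` H\<close> into \<open>H\<close>.\<close>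

definition F_Gamma :: "'a::chilbert_space set \<Rightarrow> ('n::finite \<Rightarrow> 'a \<Rightarrow> 'a) \<Rightarrow> 'a ^ 'n \<Rightarrow> 'a" where
  "F_Gamma H P = (\<lambda>x\<in>F_space H P. \<Sum>i\<in>UNIV. x $ i)"

definition F_Q ::
    "'a::chilbert_space set \<Rightarrow> ('n::finite \<Rightarrow> 'a \<Rightarrow> 'a) \<Rightarrow> 'n \<Rightarrow> 'a ^ 'n \<Rightarrow> 'a ^ 'n" where
  "F_Q H P i = (\<lambda>x\<in>F_space H P. \<chi> j. if j = i then x $ j else 0)"

definition F_P ::
    "real \<Rightarrow> 'a::chilbert_space set \<Rightarrow> ('n::finite \<Rightarrow> 'a \<Rightarrow> 'a) \<Rightarrow> 'a ^ 'n \<Rightarrow> 'a ^ 'n" where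
  "F_P \<alpha> H P = (\<lambda>x\<in>F_space H P.
     (1 / \<alpha>) *\<^sub>R adj (F_space H P) H (F_Gamma H P) (F_Gamma H P x))"

text \<open>The \<open>n + 1\<close> subspaces are indexed by \<^typ>\<open>'n option\<close>, \<^term>\<open>None\<close> being the last one.\<close>

definition S_F :: "real \<Rightarrow> 'a::chilbert_space set \<Rightarrow> ('n::finite \<Rightarrow> 'a \<Rightarrow> 'a) \<Rightarrow>
    ('a ^ 'n, 'n option) subspace_system" where
  "S_F \<alpha> H P = \<lparr>whole = F_space H P,
     sub = (\<lambda>k. case k of Some i \<Rightarrow> F_Q H P i ` F_space H P | None \<Rightarrow> F_P \<alpha> H P ` F_space H P)\<rparr>"


section \<open>The discrete spectrum\<close>

text \<open>Iterating \<open>x \<mapsto> 1 + 1 / (n - 1 - x)\<close> adds one level to the continued fractions: if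
  \<open>x = 1 + 1 / y\<close> then \<open>n - 1 - x = (n - 2) - 1 / y\<close>.\<close>

definition spectrum_step :: "nat \<Rightarrow> real \<Rightarrow> real" where
  "spectrum_step n x = 1 + 1 / (real n - 1 - x)"

definition Lambda0 :: "nat \<Rightarrow> real set" where
  "Lambda0 n = range (\<lambda>k. (spectrum_step n ^^ k) 0)"

definition Lambda1 :: "nat \<Rightarrow> real set" where
  "Lambda1 n = range (\<lambda>k. (spectrum_step n ^^ k) 1)"

definition discrete_spectrum :: "nat \<Rightarrow> real set" where
  "discrete_spectrum n = Lambda0 n \<union> Lambda1 n \<union>
     (\<lambda>x. real n - x) ` Lambda1 n \<union> (\<lambda>x. real n - x) ` Lambda0 n"


section \<open>Well-definedness of \<open>F\<close>\<close>

lemma bounded_opsD: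
  assumes "T \<in> bounded_ops H K"
  shows "x \<in> H \<Longrightarrow> T x \<in> K" "x \<in> H \<Longrightarrow> y \<in> H \<Longrightarrow> T (x + y) = T x + T y"
    "x \<in> H \<Longrightarrow> T (c *\<^sub>C x) = c *\<^sub>C T x" "\<exists>C. \<forall>x\<in>H. norm (T x) \<le> C * norm x"
  using assms by (auto simp: bounded_ops_def)

lemma csubspaceD:
  assumes "csubspace M"
  shows "0 \<in> M" "x \<in> M \<Longrightarrow> y \<in> M \<Longrightarrow> x + y \<in> M" "x \<in> M \<Longrightarrow> c *\<^sub>C x \<in> M"
    "x \<in> M \<Longrightarrow> r *\<^sub>R x \<in> M" "x \<in> M \<Longrightarrow> y \<in> M \<Longrightarrow> x - y \<in> M"
proof -
  show *: "0 \<in> M" "x \<in> M \<Longrightarrow> y \<in> M \<Longrightarrow> x + y \<in> M" "x \<in> M \<Longrightarrow> c *\<^sub>C x \<in> M" for x y c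
    using assms by (auto simp: csubspace_def)
  show **: "x \<in> M \<Longrightarrow> r *\<^sub>R x \<in> M" for x r
    using *(3)[of x "complex_of_real r"] by (simp add: scaleC_of_real)
  show "x \<in> M \<Longrightarrow> y \<in> M \<Longrightarrow> x - y \<in> M"
    using *(2)[of x "(-1) *\<^sub>R y"] **[of y "-1"] by simp
qed

lemma csubspace_sum:
  assumes "csubspace M" "\<And>i. i \<in> A \<Longrightarrow> f i \<in> M"
  shows "(\<Sum>i\<in>A. f i) \<in> M"
  using assms(2) by (induction A rule: infinite_finite_induct) (auto intro: csubspaceD[OF assms(1)])

lemma bounded_ops_diff:
  assumes "T \<in> bounded_ops H K" "csubspace H" "x \<in> H" "y \<in> H"
  shows "T (x - y) = T x - T y"
  using bounded_opsD(2)[OF assms(1) csubspaceD(5)[OF assms(2,3,4)] assms(4)] by simp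

lemma is_adjoint_unique:
  assumes "is_adjoint H K T A" "is_adjoint H K T B" "csubspace H"
  shows "A = B"
proof (rule extensionalityI[of _ K])
  show "A \<in> extensional K" "B \<in> extensional K"
    using assms(1,2) by (auto simp: is_adjoint_def bounded_ops_def PiE_def)
  fix y assume y: "y \<in> K"
  have AB: "A y \<in> H" "B y \<in> H"
    using assms(1,2) y by (auto simp: is_adjoint_def dest: bounded_opsD(1))
  have "cinner x (A y) = cinner x (B y)" if "x \<in> H" for x
    using assms(1,2) y that by (auto simp: is_adjoint_def)
  from this[of "A y - B y"] have "cinner (A y - B y) (A y - B y) = 0"
    using csubspaceD(5)[OF assms(3) AB] by (simp add: cinner_diff_right)
  then show "A y = B y" by (simp add: cinner_self_eq_0)
qed

lemma adj_eqI: "is_adjoint H K T A \<Longrightarrow> csubspace H \<Longrightarrow> adj H K T = A"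
  unfolding adj_def by (blast intro: the_equality is_adjoint_unique)

lemma closed_csubspace_projection_image:
  assumes "closed_csubspace H" "orth_projection H p"
  shows "closed_csubspace (p ` H)"
proof -
  have H: "csubspace H" "closed H" using assms(1) by (auto simp: closed_csubspace_def)
  have p: "p \<in> bounded_ops H H" and idem: "\<And>x. x \<in> H \<Longrightarrow> p (p x) = p x"
    using assms(2) by (auto simp: orth_projection_def)
  have "csubspace (p ` H)"
    unfolding csubspace_def
  proof (intro conjI ballI allI)
    have "p (0 *\<^sub>C 0) = 0 *\<^sub>C p 0" by (rule bounded_opsD(3)[OF p csubspaceD(1)[OF H(1)]])
    then have "p 0 = 0" using scaleC_of_real[of 0 "p 0"] by simp
    then show "0 \<in> p ` H" using csubspaceD(1)[OF H(1)] by (metis imageI)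
  next
    fix x y assume "x \<in> p ` H" "y \<in> p ` H"
    then show "x + y \<in> p ` H"
      using bounded_opsD(2)[OF p] csubspaceD(2)[OF H(1)] by (metis (no_types, lifting) imageE imageI)
  next
    fix c x assume "x \<in> p ` H"
    then show "c *\<^sub>C x \<in> p ` H"
      using bounded_opsD(3)[OF p] csubspaceD(3)[OF H(1)] by (metis (no_types, lifting) imageE imageI)
  qed
  moreover have "closed (p ` H)"
    unfolding closed_sequential_limits
  proof (intro allI impI, elim conjE)
    fix f l assume f: "\<forall>n. f n \<in> p ` H" and l: "f \<longlonglongrightarrow> l"
    have fH: "f n \<in> H" and pf: "p (f n) = f n" for n
      using f idem bounded_opsD(1)[OF p] by (metis imageE)+
    have lH: "l \<in> H" using H(2) fH l by (meson closed_sequentially)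
    obtain C where C: "\<And>x. x \<in> H \<Longrightarrow> norm (p x) \<le> C * norm x" using bounded_opsD(4)[OF p] by blast
    have "norm (f n - p l) \<le> C * norm (f n - l)" for n
      using C[OF csubspaceD(5)[OF H(1) fH[of n] lH]] bounded_ops_diff[OF p H(1) fH[of n] lH] pf
      by simp
    moreover have "(\<lambda>n. C * norm (f n - l)) \<longlonglongrightarrow> 0"
      using l by (auto intro!: tendsto_mult_right_zero simp: tendsto_norm_zero_iff LIM_zero_iff)
    ultimately have "(\<lambda>n. f n - p l) \<longlonglongrightarrow> 0"
      by (intro Lim_null_comparison[of "\<lambda>n. f n - p l"]) auto
    then have "f \<longlonglongrightarrow> p l" by (simp add: LIM_zero_iff)
    then have "l = p l" using l LIMSEQ_unique by blast
    then show "l \<in> p ` H" using lH by blast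
  qed
  ultimately show ?thesis by (simp add: closed_csubspace_def)
qed

context
  fixes \<alpha> :: real and H :: "'a::chilbert_space set" and P :: "'n::finite \<Rightarrow> 'a \<Rightarrow> 'a"
  assumes rep: "is_rep \<alpha> H P"
begin

lemma rep_facts:
  shows "csubspace H" "closed H" "H \<noteq> {0}" "P i \<in> bounded_ops H H"
    "x \<in> H \<Longrightarrow> P i x \<in> H" "x \<in> H \<Longrightarrow> P i (P i x) = P i x"
    "x \<in> H \<Longrightarrow> y \<in> H \<Longrightarrow> cinner (P i x) y = cinner x (P i y)"
    "x \<in> H \<Longrightarrow> (\<Sum>i\<in>UNIV. P i x) = \<alpha> *\<^sub>R x" "closed_csubspace (P i ` H)"
  using rep closed_csubspace_projection_image[of H "P i"]
  by (auto simp: is_rep_def hilbert_def closed_csubspace_def orth_projection_def is_adjoint_def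
      intro: bounded_opsD(1))

lemma mem_image_iff: "x \<in> P i ` H \<longleftrightarrow> x \<in> H \<and> P i x = x"
proof
  assume "x \<in> P i ` H"
  then obtain y where "y \<in> H" "x = P i y" by blast
  then show "x \<in> H \<and> P i x = x" using rep_facts(5,6)[of y i] by simp
next
  assume "x \<in> H \<and> P i x = x"
  then show "x \<in> P i ` H" by (metis imageI)
qed

lemma F_space_iff: "x \<in> F_space H P \<longleftrightarrow> (\<forall>i. x $ i \<in> H \<and> P i (x $ i) = x $ i)"
  by (simp add: F_space_def mem_image_iff)

lemma closed_csubspace_F_space: "closed_csubspace (F_space H P)"
proof -
  have *: "csubspace (P i ` H)" "closed (P i ` H)" for i
    using rep_facts(9) by (auto simp: closed_csubspace_def)
  have "csubspace (F_space H P)"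
    unfolding F_space_def csubspace_def
    by (auto simp: scaleC_vec_def intro!: csubspaceD(1-3)[OF *(1)])
  moreover have "F_space H P = (\<Inter>i. (\<lambda>x. x $ i) -` (P i ` H))"
    by (auto simp: F_space_def)
  then have "closed (F_space H P)"
    using *(2) by (auto intro!: closed_vimage continuous_intros)
  ultimately show ?thesis by (simp add: closed_csubspace_def)
qed

lemma is_adjoint_F_Gamma:
  "is_adjoint (F_space H P) H (F_Gamma H P) (\<lambda>y\<in>H. \<chi> i. P i y)"
proof -
  have "(\<lambda>y\<in>H. \<chi> i. P i y) \<in> bounded_ops H (F_space H P)"
    unfolding bounded_ops_def
  proof (intro CollectI conjI ballI allI)
    show "(\<lambda>y\<in>H. \<chi> i. P i y) \<in> H \<rightarrow>\<^sub>E F_space H P"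
      by (auto simp: F_space_def)
    fix x assume x: "x \<in> H"
    show "(\<lambda>y\<in>H. \<chi> i. P i y) (c *\<^sub>C x) = c *\<^sub>C (\<lambda>y\<in>H. \<chi> i. P i y) x" for c
      using x bounded_opsD(3)[OF rep_facts(4)] csubspaceD(3)[OF rep_facts(1)]
      by (auto simp: scaleC_vec_def vec_eq_iff)
    fix y assume y: "y \<in> H"
    show "(\<lambda>y\<in>H. \<chi> i. P i y) (x + y) = (\<lambda>y\<in>H. \<chi> i. P i y) x + (\<lambda>y\<in>H. \<chi> i. P i y) y"
      using x y bounded_opsD(2)[OF rep_facts(4)] csubspaceD(2)[OF rep_facts(1)]
      by (auto simp: vec_eq_iff)
  next
    have "\<forall>i. \<exists>C. \<forall>x\<in>H. norm (P i x) \<le> C * norm x"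
      using bounded_opsD(4)[OF rep_facts(4)] by blast
    then obtain C where C: "\<And>i x. x \<in> H \<Longrightarrow> norm (P i x) \<le> C i * norm x" by metis
    have "norm (\<chi> i. P i x) \<le> (\<Sum>i\<in>UNIV. C i) * norm x" if "x \<in> H" for x
    proof -
      have "norm (\<chi> i. P i x) \<le> (\<Sum>i\<in>UNIV. norm (P i x))"
        unfolding norm_vec_def by (rule order_trans[OF L2_set_le_sum]) auto
      also have "\<dots> \<le> (\<Sum>i\<in>UNIV. C i) * norm x"
        unfolding sum_distrib_right by (intro sum_mono C that)
      finally show ?thesis .
    qed
    then show "\<exists>C. \<forall>x\<in>H. norm ((\<lambda>y\<in>H. \<chi> i. P i y) x) \<le> C * norm x" by auto
  qed
  moreover have "cinner (F_Gamma H P x) y = cinner x ((\<lambda>y\<in>H. \<chi> i. P i y) y)"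
    if "x \<in> F_space H P" "y \<in> H" for x y
  proof -
    have "cinner (x $ i) y = cinner (x $ i) (P i y)" for i
      using that rep_facts(7)[of "x $ i" y i] by (metis F_space_iff)
    then show ?thesis
      using that by (simp add: F_Gamma_def cinner_vec_def cinner_sum_left)
  qed
  ultimately show ?thesis by (simp add: is_adjoint_def)
qed

lemma F_P_apply:
  assumes "x \<in> F_space H P"
  shows "F_P \<alpha> H P x = (\<chi> i. (1 / \<alpha>) *\<^sub>R P i (\<Sum>j\<in>UNIV. x $ j))"
proof -
  have "(\<Sum>j\<in>UNIV. x $ j) \<in> H"
    using assms by (intro csubspace_sum rep_facts(1)) (auto simp: F_space_iff)
  then show ?thesis
    using assms adj_eqI[OF is_adjoint_F_Gamma] closed_csubspace_F_space
    by (simp add: F_P_def F_Gamma_def closed_csubspace_def vec_eq_iff)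
qed

lemma F_Q_apply:
  assumes "x \<in> F_space H P"
  shows "F_Q H P i x = (\<chi> j. if j = i then x $ j else 0)" "F_Q H P i x \<in> F_space H P"
proof -
  show *: "F_Q H P i x = (\<chi> j. if j = i then x $ j else 0)"
    using assms by (simp add: F_Q_def)
  have "0 \<in> P j ` H" for j
    using rep_facts(9)[of j] by (simp add: closed_csubspace_def csubspace_def)
  then show "F_Q H P i x \<in> F_space H P"
    unfolding * using assms by (auto simp: F_space_def)
qed

lemma csubspace_F_space: "csubspace (F_space H P)"
  using closed_csubspace_F_space by (simp add: closed_csubspace_def)

lemma orth_projection_F_Q: "orth_projection (F_space H P) (F_Q H P i)"
proof -
  note sub = csubspaceD[OF csubspace_F_space]
  have "F_Q H P i \<in> bounded_ops (F_space H P) (F_space H P)"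
    unfolding bounded_ops_def
  proof (intro CollectI conjI ballI allI)
    show "F_Q H P i \<in> F_space H P \<rightarrow>\<^sub>E F_space H P"
      using F_Q_apply(2) by (auto simp: F_Q_def PiE_iff extensional_def)
    fix x assume x: "x \<in> F_space H P"
    show "F_Q H P i (c *\<^sub>C x) = c *\<^sub>C F_Q H P i x" for c
      using x sub(3)[OF x] by (simp add: F_Q_apply scaleC_vec_def vec_eq_iff)
    fix y assume y: "y \<in> F_space H P"
    show "F_Q H P i (x + y) = F_Q H P i x + F_Q H P i y"
      using x y sub(2)[OF x y] by (simp add: F_Q_apply vec_eq_iff)
  next
    have "norm (F_Q H P i x) \<le> 1 * norm x" if "x \<in> F_space H P" for x
      using that by (auto simp: F_Q_apply norm_vec_def intro!: L2_set_mono)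
    then show "\<exists>C. \<forall>x\<in>F_space H P. norm (F_Q H P i x) \<le> C * norm x" by blast
  qed
  moreover have "F_Q H P i (F_Q H P i x) = F_Q H P i x" if "x \<in> F_space H P" for x
    using that F_Q_apply(2)[OF that, of i] by (simp add: F_Q_apply vec_eq_iff)
  moreover have "cinner (F_Q H P i x) y = cinner x (F_Q H P i y)"
    if "x \<in> F_space H P" "y \<in> F_space H P" for x y
    using that by (auto simp: F_Q_apply cinner_vec_def intro!: sum.cong)
  ultimately show ?thesis by (simp add: orth_projection_def is_adjoint_def)
qed

lemma orth_projection_F_P:
  assumes "\<alpha> \<noteq> 0"
  shows "orth_projection (F_space H P) (F_P \<alpha> H P)"
proof -
  note sub = csubspaceD[OF csubspace_F_space]
  define A where "A = (\<lambda>y\<in>H. \<chi> i. P i y)"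
  have A: "A \<in> bounded_ops H (F_space H P)"
    and adj: "\<And>x y. x \<in> F_space H P \<Longrightarrow> y \<in> H \<Longrightarrow> cinner (F_Gamma H P x) y = cinner x (A y)"
    using is_adjoint_F_Gamma by (auto simp: is_adjoint_def A_def)
  have \<Gamma>H: "F_Gamma H P x \<in> H" if "x \<in> F_space H P" for x
    using that by (auto simp: F_Gamma_def F_space_iff intro!: csubspace_sum rep_facts(1))
  have FP: "F_P \<alpha> H P x = (1 / \<alpha>) *\<^sub>R A (F_Gamma H P x)" if "x \<in> F_space H P" for x
    using that adj_eqI[OF is_adjoint_F_Gamma csubspace_F_space] by (simp add: F_P_def A_def)
  have FPin: "F_P \<alpha> H P x \<in> F_space H P" if "x \<in> F_space H P" for x
    unfolding FP[OF that] by (intro sub(4) bounded_opsD(1)[OF A] \<Gamma>H that)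
  have "F_P \<alpha> H P \<in> bounded_ops (F_space H P) (F_space H P)"
    unfolding bounded_ops_def
  proof (intro CollectI conjI ballI allI)
    show "F_P \<alpha> H P \<in> F_space H P \<rightarrow>\<^sub>E F_space H P"
      using FPin by (auto simp: F_P_def PiE_iff extensional_def)
    fix x assume x: "x \<in> F_space H P"
    have "F_Gamma H P (c *\<^sub>C x) = c *\<^sub>C F_Gamma H P x" for c
      using x sub(3)[OF x] by (simp add: F_Gamma_def scaleC_vec_def scaleC_sum_right)
    then show "F_P \<alpha> H P (c *\<^sub>C x) = c *\<^sub>C F_P \<alpha> H P x" for c
      using x sub(3)[OF x] bounded_opsD(3)[OF A \<Gamma>H[OF x]]
      by (simp add: FP scaleC_scaleC mult.commute flip: scaleC_of_real)
    fix y assume y: "y \<in> F_space H P"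
    have "F_Gamma H P (x + y) = F_Gamma H P x + F_Gamma H P y"
      using x y sub(2)[OF x y] by (simp add: F_Gamma_def sum.distrib)
    then show "F_P \<alpha> H P (x + y) = F_P \<alpha> H P x + F_P \<alpha> H P y"
      using x y sub(2)[OF x y] bounded_opsD(2)[OF A \<Gamma>H[OF x] \<Gamma>H[OF y]]
      by (simp add: FP scaleR_add_right)
  next
    obtain C where C: "\<And>x. x \<in> H \<Longrightarrow> norm (A x) \<le> C * norm x" using bounded_opsD(4)[OF A] by blast
    have "norm (F_P \<alpha> H P x) \<le> (\<bar>1 / \<alpha>\<bar> * (\<bar>C\<bar> * real CARD('n))) * norm x"
      if x: "x \<in> F_space H P" for x
    proof -
      have "norm (F_Gamma H P x) \<le> (\<Sum>i\<in>UNIV. norm (x $ i))"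
        using x by (simp add: F_Gamma_def sum_norm_le)
      also have "\<dots> \<le> real CARD('n) * norm x"
        by (rule order_trans[OF sum_bounded_above[of _ _ "norm x"]])
          (auto simp: Finite_Cartesian_Product.norm_nth_le)
      finally have 1: "norm (F_Gamma H P x) \<le> real CARD('n) * norm x" .
      have "norm (A (F_Gamma H P x)) \<le> C * norm (F_Gamma H P x)" by (rule C[OF \<Gamma>H[OF x]])
      also have "\<dots> \<le> \<bar>C\<bar> * norm (F_Gamma H P x)" by (simp add: mult_right_mono)
      also have "\<dots> \<le> \<bar>C\<bar> * (real CARD('n) * norm x)" by (intro mult_left_mono 1) simp
      finally have "\<bar>1 / \<alpha>\<bar> * norm (A (F_Gamma H P x)) \<le> \<bar>1 / \<alpha>\<bar> * (\<bar>C\<bar> * (real CARD('n) * norm x))"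
        by (intro mult_left_mono) auto
      then show ?thesis by (simp add: FP[OF x] mult.assoc)
    qed
    then show "\<exists>C. \<forall>x\<in>F_space H P. norm (F_P \<alpha> H P x) \<le> C * norm x" by blast
  qed
  moreover have "F_P \<alpha> H P (F_P \<alpha> H P x) = F_P \<alpha> H P x" if x: "x \<in> F_space H P" for x
  proof -
    have "F_Gamma H P (F_P \<alpha> H P x) = (1 / \<alpha>) *\<^sub>R (\<Sum>i\<in>UNIV. P i (F_Gamma H P x))"
      using FPin[OF x] \<Gamma>H[OF x] by (simp add: F_Gamma_def[of H P] FP[OF x] scaleR_sum_right)
        (simp add: A_def F_Gamma_def x)
    also have "\<dots> = F_Gamma H P x"
      using rep_facts(8)[OF \<Gamma>H[OF x]] assms by simp
    finally show ?thesis using x FPin[OF x] by (simp add: FP)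
  qed
  moreover have "cinner (F_P \<alpha> H P x) y = cinner x (F_P \<alpha> H P y)"
    if x: "x \<in> F_space H P" and y: "y \<in> F_space H P" for x y
  proof -
    have "cinner (A (F_Gamma H P x)) y = cinner (F_Gamma H P x) (F_Gamma H P y)"
      using adj[OF y \<Gamma>H[OF x]] by (metis cinner_commute)
    then show ?thesis
      using adj[OF x \<Gamma>H[OF y]] FP[OF x] FP[OF y]
      by (simp add: cinner_scaleC_left cinner_scaleC_right flip: scaleC_of_real)
  qed
  ultimately show ?thesis by (simp add: orth_projection_def is_adjoint_def)
qed

lemma hilbert_F_space:
  assumes "\<alpha> \<noteq> 0"
  shows "hilbert (F_space H P)"
proof -
  obtain x where x: "x \<in> H" "x \<noteq> 0"
    using rep_facts(3) csubspaceD(1)[OF rep_facts(1)] by blast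
  then have "(\<Sum>i\<in>UNIV. P i x) \<noteq> 0" using rep_facts(8)[OF x(1)] assms by simp
  then obtain i where "P i x \<noteq> 0" by (meson sum.neutral)
  then have "(\<chi> i. P i x) \<noteq> 0" by (auto simp: vec_eq_iff)
  moreover have "(\<chi> i. P i x) \<in> F_space H P" using x by (simp add: F_space_def)
  ultimately show ?thesis using closed_csubspace_F_space by (auto simp: hilbert_def)
qed

lemma is_rep_abo_F:
  assumes "\<alpha> \<noteq> 0"
  shows "is_rep_abo (1 / \<alpha>) (F_space H P) (F_Q H P) (F_P \<alpha> H P)"
proof -
  have "(\<Sum>i\<in>UNIV. F_Q H P i x) = x" if "x \<in> F_space H P" for x
    using that by (simp add: F_Q_apply vec_eq_iff)
  moreover have "F_Q H P j (F_P \<alpha> H P (F_Q H P j x)) = (1 / \<alpha>) *\<^sub>R F_Q H P j x"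
    if x: "x \<in> F_space H P" for j x
  proof -
    have Q: "F_Q H P j x \<in> F_space H P" by (rule F_Q_apply(2)[OF x])
    have "F_P \<alpha> H P (F_Q H P j x) \<in> F_space H P"
      using orth_projection_F_P[OF assms] Q
      by (auto simp: orth_projection_def dest: bounded_opsD(1))
    moreover have "P j (x $ j) = x $ j" using x by (simp add: F_space_iff)
    ultimately show ?thesis
      using x F_P_apply[OF Q] by (simp add: F_Q_apply(1) vec_eq_iff)
  qed
  ultimately show ?thesis
    using hilbert_F_space orth_projection_F_Q orth_projection_F_P assms
    by (simp add: is_rep_abo_def)
qed

lemma is_subspace_system_S_F:
  assumes "\<alpha> \<noteq> 0"
  shows "is_subspace_system (S_F \<alpha> H P)"
proof -
  have "closed_csubspace (p ` F_space H P) \<and> p ` F_space H P \<subseteq> F_space H P"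
    if "orth_projection (F_space H P) p" for p
    using closed_csubspace_projection_image[OF closed_csubspace_F_space that] that
    by (auto simp: orth_projection_def dest: bounded_opsD(1))
  then show ?thesis
    using hilbert_F_space orth_projection_F_Q orth_projection_F_P assms
    by (auto simp: is_subspace_system_def S_F_def split: option.splits)
qed

end

end

theory Submission
  imports Defs "HOL-Library.Function_Algebras"
    "HOL-Computational_Algebra.Fundamental_Theorem_Algebra"
begin

text \<open>A block diagonal operator \<open>R\<close> on \<open>\<Oplus> Im P\<^sub>i\<close> maps \<open>Im P\<close> into \<open>Im P'\<close> precisely when
\<open>R\<^sub>i P\<^sub>i = P'\<^sub>i A\<close> for an operator \<open>A : H \<rightarrow> H'\<close>, because \<open>Im P = {(P\<^sub>i y)\<^sub>i : y \<in> H}\<close>.  Such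
\<open>R\<^sub>i\<close> exist for a given \<open>A\<close> exactly if \<open>A\<close> maps \<open>ker P\<^sub>i\<close> into \<open>ker P'\<^sub>i\<close>, that is, if
\<open>P'\<^sub>i A P\<^sub>i = P'\<^sub>i A\<close>.  So morphisms between the systems of \<open>n + 1\<close> subspaces are the same as morphisms
between the systems of \<open>n\<close> kernels (locale \<open>system_morphism\<close>).

In finite dimension such an \<open>A\<close> is rigid, by a computation with the Hilbert-Schmidt norm (lemma
\<open>defect\<close>).  Indeed \<open>\<Sum>\<^sub>i \<parallel>A P\<^sub>i\<parallel>\<^sup>2 = \<alpha> \<parallel>A\<parallel>\<^sup>2\<close>, while
\<open>\<Sum>\<^sub>i \<parallel>P'\<^sub>i A P\<^sub>i\<parallel>\<^sup>2 = \<Sum>\<^sub>i \<parallel>P'\<^sub>i A\<parallel>\<^sup>2 = \<alpha>' \<parallel>A\<parallel>\<^sup>2\<close>.  Since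
\<open>A P\<^sub>i - P'\<^sub>i A = (1 - P'\<^sub>i) A P\<^sub>i\<close> is orthogonal to \<open>P'\<^sub>i A P\<^sub>i\<close>, it follows that
\<open>\<Sum>\<^sub>i \<parallel>A P\<^sub>i - P'\<^sub>i A\<parallel>\<^sup>2 = (\<alpha> - \<alpha>') \<parallel>A\<parallel>\<^sup>2\<close>.  A nonzero morphism forces \<open>\<alpha>' \<le> \<alpha>\<close>, so isomorphic systems
come from equal \<open>\<alpha>\<close>, and for \<open>\<alpha> = \<alpha>'\<close> every morphism intertwines the two representations.  By
Schur's lemma an endomorphism is then a scalar, which is transitivity.  For an invertible
intertwiner \<open>A\<close>, Schur's lemma applied to \<open>A\<^sup>* A\<close> shows that \<open>A\<close> is a multiple of a unitary, so the
representations are unitarily equivalent.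

Infinite-dimensional irreducible representations have to be excluded, and here the discrete
spectrum enters: for \<open>\<alpha>\<close> in it, every representation has a nonzero finite-dimensional invariant
subspace (lemma \<open>has_finite_invariant_discrete_spectrum\<close>).  The existence of such a subspace for
\<open>P\<close> follows from its existence for the complementary projections \<open>1 - P\<^sub>i\<close>, whose sum is \<open>n - \<alpha>\<close>, and
from its existence for the reflected family, which lives on the kernel of \<open>(x\<^sub>i) \<mapsto> \<Sum> x\<^sub>i\<close> in
\<open>\<Oplus> Im P\<^sub>i\<close> and has sum \<open>\<alpha> / (\<alpha> - 1)\<close>.  If \<open>\<alpha> = 1 + 1 / (n - 1 - x)\<close>, then \<open>\<alpha> / (\<alpha> - 1) = n - x\<close>, so
reflection followed by complement goes one step back along the orbit, from \<open>\<alpha>\<close> to \<open>x\<close>.  At the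
end of the orbit, for \<open>0\<close> or \<open>1\<close>, positivity of the inner product yields an invariant line.\<close>

section \<open>Families of self-adjoint idempotents\<close>

text \<open>The form \<open>b\<close> and the subspace \<open>V\<close> are parameters because the reflection below builds new spaces with
new inner products.\<close>
locale projection_family =
  fixes \<alpha> :: real and V :: "'v::real_vector set" and b :: "'v \<Rightarrow> 'v \<Rightarrow> real"
    and P :: "'n::finite \<Rightarrow> 'v \<Rightarrow> 'v"
  assumes subspace_V: "subspace V" and nonzero: "V \<noteq> {0}"
    and form_add: "\<lbrakk>x \<in> V; y \<in> V; z \<in> V\<rbrakk> \<Longrightarrow> b (x + y) z = b x z + b y z"
    and form_scaleR: "\<lbrakk>x \<in> V; z \<in> V\<rbrakk> \<Longrightarrow> b (r *\<^sub>R x) z = r * b x z"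
    and form_commute: "\<lbrakk>x \<in> V; y \<in> V\<rbrakk> \<Longrightarrow> b x y = b y x"
    and form_pos: "\<lbrakk>x \<in> V; x \<noteq> 0\<rbrakk> \<Longrightarrow> b x x > 0"
    and P_in: "x \<in> V \<Longrightarrow> P i x \<in> V"
    and P_add: "\<lbrakk>x \<in> V; y \<in> V\<rbrakk> \<Longrightarrow> P i (x + y) = P i x + P i y"
    and P_scaleR: "x \<in> V \<Longrightarrow> P i (r *\<^sub>R x) = r *\<^sub>R P i x"
    and P_idem: "x \<in> V \<Longrightarrow> P i (P i x) = P i x"
    and P_selfadjoint: "\<lbrakk>x \<in> V; y \<in> V\<rbrakk> \<Longrightarrow> b (P i x) y = b x (P i y)"
    and P_sum: "x \<in> V \<Longrightarrow> (\<Sum>i\<in>UNIV. P i x) = \<alpha> *\<^sub>R x"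
begin

lemmas V_0 = subspace_0[OF subspace_V]
  and V_add = subspace_add[OF subspace_V]
  and V_diff = subspace_diff[OF subspace_V]
  and V_scaleR = subspace_scale[OF subspace_V]
  and V_sum = subspace_sum[OF subspace_V]

lemma P_diff: "\<lbrakk>x \<in> V; y \<in> V\<rbrakk> \<Longrightarrow> P i (x - y) = P i x - P i y"
  using P_add[of "x - y" y i] V_diff[of x y] by simp

lemma P_0 [simp]: "P i 0 = 0"
  using P_diff[of 0 0 i] V_0 by simp

lemma P_sum_right: "(\<And>a. a \<in> A \<Longrightarrow> f a \<in> V) \<Longrightarrow> P i (\<Sum>a\<in>A. f a) = (\<Sum>a\<in>A. P i (f a))"
  by (induction A rule: infinite_finite_induct) (auto simp: P_add V_sum)

lemma form_0 [simp]: "z \<in> V \<Longrightarrow> b 0 z = 0"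
  using form_scaleR[of z z 0] by simp

lemma form_diff: "\<lbrakk>x \<in> V; y \<in> V; z \<in> V\<rbrakk> \<Longrightarrow> b (x - y) z = b x z - b y z"
  using form_add[of "x - y" y z] V_diff[of x y] by simp

lemma form_sum: "\<lbrakk>\<And>a. a \<in> A \<Longrightarrow> f a \<in> V; z \<in> V\<rbrakk> \<Longrightarrow> b (\<Sum>a\<in>A. f a) z = (\<Sum>a\<in>A. b (f a) z)"
  by (induction A rule: infinite_finite_induct) (auto simp: form_add V_sum)

lemma form_nonneg: "x \<in> V \<Longrightarrow> b x x \<ge> 0"
  using form_pos[of x] by (cases "x = 0") (auto simp: V_0 less_imp_le)

text \<open>Since \<open>b (P\<^sub>i x) (P\<^sub>i x) = b (P\<^sub>i x) x\<close>, the energies of the components \<open>P\<^sub>i x\<close> add up as the \<open>P\<^sub>i\<close> do.\<close>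
lemma sum_form_P: "x \<in> V \<Longrightarrow> (\<Sum>i\<in>UNIV. b (P i x) (P i x)) = \<alpha> * b x x"
proof -
  assume x: "x \<in> V"
  have "(\<Sum>i\<in>UNIV. b (P i x) (P i x)) = (\<Sum>i\<in>UNIV. b (P i x) x)"
    using x by (simp add: P_selfadjoint P_in P_idem)
  also have "\<dots> = b (\<Sum>i\<in>UNIV. P i x) x"
    using x by (simp add: form_sum P_in)
  finally show ?thesis
    using x by (simp add: P_sum form_scaleR)
qed

lemma ex_nonzero_in_range:
  assumes "\<alpha> \<noteq> 0"
  obtains i v where "v \<in> V" "P i v = v" "v \<noteq> 0"
proof -
  obtain x where x: "x \<in> V" "x \<noteq> 0"
    using nonzero V_0 by blast
  then have "(\<Sum>i\<in>UNIV. P i x) \<noteq> 0"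
    using assms by (simp add: P_sum)
  then obtain i where "P i x \<noteq> 0"
    by (meson sum.neutral)
  then show thesis
    using that[of "P i x" i] x by (auto simp: P_in P_idem)
qed

text \<open>Finite-dimensional invariant subspaces are represented by finite spanning sets, which the
constructions below transport without any dimension theory.\<close>
definition "has_finite_invariant \<longleftrightarrow>
  (\<exists>E. finite E \<and> E \<subseteq> V \<and> \<not> E \<subseteq> {0} \<and> (\<forall>i. P i ` E \<subseteq> span E))"

lemma has_finite_invariant_0:
  assumes "\<alpha> = 0"
  shows has_finite_invariant
proof -
  obtain x where x: "x \<in> V" "x \<noteq> 0"
    using nonzero V_0 by blast
  have "(\<Sum>i\<in>UNIV. b (P i x) (P i x)) = 0"
    using sum_form_P[OF x(1)] assms by simp
  then have "b (P i x) (P i x) = 0" for i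
    using x by (subst (asm) sum_nonneg_eq_0_iff) (auto simp: form_nonneg P_in)
  then have "P i x = 0" for i
    using form_pos[of "P i x"] x by (force simp: P_in)
  then show ?thesis
    unfolding has_finite_invariant_def using x by (intro exI[of _ "{x}"]) (auto simp: span_0)
qed

text \<open>If \<open>P\<^sub>i v = v\<close>, then \<open>P\<^sub>i\<close> already exhausts the total energy of \<open>v\<close>, so the other projections
annihilate \<open>v\<close> and \<open>v\<close> spans an invariant line.\<close>
lemma has_finite_invariant_1:
  assumes "\<alpha> = 1"
  shows has_finite_invariant
proof -
  obtain i v where v: "v \<in> V" "P i v = v" "v \<noteq> 0"
    using ex_nonzero_in_range assms by (metis zero_neq_one)
  have "(\<Sum>j\<in>UNIV - {i}. b (P j v) (P j v)) = 0"
    using sum_form_P[OF v(1)] assms v by (simp add: sum.remove[of UNIV i])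
  then have "b (P j v) (P j v) = 0" if "j \<noteq> i" for j
    using v that by (subst (asm) sum_nonneg_eq_0_iff) (auto simp: form_nonneg P_in)
  then have "P j v = 0" if "j \<noteq> i" for j
    using form_pos[of "P j v"] v that by (force simp: P_in)
  then have "P j v \<in> span {v}" for j
    by (cases "j = i") (auto simp: v span_0 span_base)
  then show ?thesis
    unfolding has_finite_invariant_def using v by (intro exI[of _ "{v}"]) auto
qed

lemma complement: "projection_family (real CARD('n) - \<alpha>) V b (\<lambda>i x. x - P i x)"
proof
  fix x y i assume xy: "x \<in> V" "y \<in> V"
  have "b x (y - P i y) = b x y - b x (P i y)"
    using xy form_diff[of y "P i y" x] by (metis P_in form_commute V_diff)
  then show "b (x - P i x) y = b x (y - P i y)"
    using xy by (simp add: form_diff P_in P_selfadjoint)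
qed (auto simp: form_add form_scaleR subspace_V nonzero form_pos V_diff P_in P_diff P_add P_scaleR
    P_idem P_sum sum_subtractf algebra_simps sum_constant_scaleR intro: form_commute)

lemma has_finite_invariant_complement:
  assumes "projection_family.has_finite_invariant V (\<lambda>i x. x - P i x)"
  shows has_finite_invariant
proof -
  interpret C: projection_family "real CARD('n) - \<alpha>" V b "\<lambda>i x. x - P i x"
    by (rule complement)
  obtain E where E: "finite E" "E \<subseteq> V" "\<not> E \<subseteq> {0}" "\<And>i. (\<lambda>x. x - P i x) ` E \<subseteq> span E"
    using assms unfolding C.has_finite_invariant_def by blast
  have "P i x \<in> span E" if "x \<in> E" for i x
    using span_diff[of x E "x - P i x"] that E(4) by (auto simp: span_base)
  then show ?thesis
    unfolding has_finite_invariant_def using E by blast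
qed

end

section \<open>The reflection\<close>

instantiation "fun" :: (type, real_vector) real_vector
begin

definition "r *\<^sub>R (f :: 'a \<Rightarrow> 'b) = (\<lambda>x. r *\<^sub>R f x)"

instance
  by standard (auto simp: scaleR_fun_def scaleR_add_right scaleR_add_left)

end

lemma scaleR_fun_apply: "(r *\<^sub>R f) w = r *\<^sub>R f w"
  by (simp add: scaleR_fun_def)

text \<open>Functions on words over the index type are isomorphic to \<open>n\<close>-tuples of such functions (up to the
value at the empty word).  Hence the repeatedly reflected spaces, which lie in larger and larger
direct sums, are all subspaces of one type, and the descent along an orbit is an ordinary induction.\<close>
definition block :: "'n \<Rightarrow> ('n list \<Rightarrow> 'a) \<Rightarrow> 'n list \<Rightarrow> 'a" where
  "block i x = (\<lambda>w. x (i # w))"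

definition from_blocks :: "('n \<Rightarrow> 'n list \<Rightarrow> 'a) \<Rightarrow> 'n list \<Rightarrow> 'a::zero" where
  "from_blocks f = (\<lambda>w. case w of [] \<Rightarrow> 0 | i # w \<Rightarrow> f i w)"

lemma block_from_blocks [simp]: "block i (from_blocks f) = f i"
  by (simp add: block_def from_blocks_def)

lemma from_blocks_Nil [simp]: "from_blocks f [] = 0"
  by (simp add: from_blocks_def)

lemma eq_if_blocks_eq:
  assumes "x [] = y []" "\<And>i. block i x = block i y"
  shows "x = y"
proof
  fix w show "x w = y w"
    using assms(1) assms(2)[THEN fun_cong] by (cases w) (auto simp: block_def)
qed

lemma sum_fun_apply: "(\<Sum>a\<in>A. f a) w = (\<Sum>a\<in>A. f a w)"
  by (induction A rule: infinite_finite_induct) auto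

lemma linear_block: "linear (block i :: ('n list \<Rightarrow> 'a::real_vector) \<Rightarrow> _)"
  by (rule linearI) (auto simp: block_def scaleR_fun_def)

lemmas block_simps [simp] = linear_0[OF linear_block] linear_add[OF linear_block]
  linear_diff[OF linear_block] linear_scale[OF linear_block] linear_sum[OF linear_block]

text \<open>The projection of \<open>\<Oplus> Im P\<^sub>i\<close> onto the kernel of the summation map compresses the coordinate
projections \<open>Q\<^sub>i\<close> to multiples of projections.  Up to that multiple, \<open>lift i v\<close> is the image under it
of the vector that has \<open>v\<close> in block \<open>i\<close> and zeros elsewhere; the factor is chosen such that block
\<open>i\<close> of \<open>lift i v\<close> is again \<open>v\<close>.\<close>
locale reflection = projection_family \<alpha> V b P
  for \<alpha> :: real and V :: "('n::finite list \<Rightarrow> 'a::real_vector) set" and b and P :: "'n \<Rightarrow> _" +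
  assumes alpha: "\<alpha> \<noteq> 0" "\<alpha> \<noteq> 1"
begin

definition "V' = {x. x [] = 0 \<and> (\<forall>i. block i x \<in> V \<and> P i (block i x) = block i x) \<and>
  (\<Sum>i\<in>UNIV. block i x) = 0}"

definition "b' x y = (\<Sum>i\<in>UNIV. b (block i x) (block i y))"

definition lift :: "'n \<Rightarrow> ('n list \<Rightarrow> 'a) \<Rightarrow> 'n list \<Rightarrow> 'a" where
  "lift i v = from_blocks (\<lambda>j. (1 / (\<alpha> - 1)) *\<^sub>R ((if j = i then \<alpha> *\<^sub>R v else 0) - P j v))"

abbreviation "P' i x \<equiv> lift i (block i x)"

lemma V'D: "x \<in> V' \<Longrightarrow> block i x \<in> V" "x \<in> V' \<Longrightarrow> P i (block i x) = block i x"
  "x \<in> V' \<Longrightarrow> (\<Sum>i\<in>UNIV. block i x) = 0" "x \<in> V' \<Longrightarrow> x [] = 0"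
  by (auto simp: V'_def)

lemma block_lift: "block j (lift i v) = (1 / (\<alpha> - 1)) *\<^sub>R ((if j = i then \<alpha> *\<^sub>R v else 0) - P j v)"
  by (simp add: lift_def)

lemma block_lift_same: "P i v = v \<Longrightarrow> block i (lift i v) = v"
proof -
  assume "P i v = v"
  moreover have "\<alpha> *\<^sub>R v - v = (\<alpha> - 1) *\<^sub>R v"
    by (simp add: scaleR_diff_left)
  ultimately show ?thesis
    using alpha by (simp add: block_lift)
qed

lemma lift_in:
  assumes "v \<in> V" "P i v = v"
  shows "lift i v \<in> V'"
proof -
  have "(\<Sum>j\<in>UNIV. block j (lift i v)) = 0"
    using assms by (simp add: block_lift sum_subtractf P_sum flip: scaleR_sum_right)
  moreover have "lift i v [] = 0"
    by (simp add: lift_def)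
  moreover have "block j (lift i v) \<in> V" for j
    unfolding block_lift using assms by (intro V_scaleR V_diff) (auto simp: P_in V_0 V_scaleR)
  moreover have "P j (block j (lift i v)) = block j (lift i v)" for j
    using assms
    by (auto simp: block_lift P_scaleR P_diff P_in P_idem V_scaleR V_diff V_0)
  ultimately show ?thesis
    by (simp add: V'_def)
qed

text \<open>The correction terms of \<open>lift i v\<close> contribute \<open>\<Sum>\<^sub>j b v (block j y)\<close>, which vanishes since the blocks of
\<open>y\<close> sum up to zero.  What remains is symmetric in \<open>v\<close> and the block of \<open>y\<close>, whence the reflected
projections are self-adjoint.\<close>
lemma form_lift:
  assumes "v \<in> V" "P i v = v" "y \<in> V'"
  shows "b' (lift i v) y = \<alpha> / (\<alpha> - 1) * b v (block i y)"
proof -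
  note y = V'D[OF assms(3)]
  have "b (block j (lift i v)) (block j y) =
    (1 / (\<alpha> - 1)) * ((if j = i then \<alpha> * b v (block i y) else 0) - b (block j y) v)" for j
  proof -
    have "b (P j v) (block j y) = b (block j y) v"
      using assms y(1,2)[of j] by (metis P_selfadjoint form_commute)
    then show ?thesis
      using assms y(1) unfolding block_lift
      by (subst form_scaleR) (auto simp: form_diff form_scaleR P_in V_diff V_scaleR V_0)
  qed
  then have "b' (lift i v) y =
    (1 / (\<alpha> - 1)) * (\<alpha> * b v (block i y) - (\<Sum>j\<in>UNIV. b (block j y) v))"
    by (simp add: b'_def sum_subtractf flip: sum_divide_distrib)
  also have "(\<Sum>j\<in>UNIV. b (block j y) v) = 0"
    using form_sum[of UNIV "\<lambda>j. block j y" v] y assms by simp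
  finally show ?thesis
    by simp
qed

lemma subspace_V': "subspace V'"
  unfolding subspace_def V'_def
  by (auto simp: V_0 V_add V_scaleR P_add P_scaleR sum.distrib scaleR_fun_apply
    simp flip: scaleR_sum_right)

lemma reflected: "projection_family (\<alpha> / (\<alpha> - 1)) V' b' P'"
proof
  show "subspace V'" by (rule subspace_V')
  obtain i v where v: "v \<in> V" "P i v = v" "v \<noteq> 0"
    using ex_nonzero_in_range alpha by metis
  then have "lift i v \<noteq> 0"
    using block_lift_same[of i v] by auto
  then show "V' \<noteq> {0}"
    using lift_in v by blast
next
  fix x y z and r assume x: "x \<in> V'" and z: "z \<in> V'"
  show "b' (r *\<^sub>R x) z = r * b' x z"
    using x z by (simp add: b'_def V'D form_scaleR sum_distrib_left)
  show "b' x z = b' z x"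
    unfolding b'_def using x z by (intro sum.cong form_commute) (auto simp: V'D)
  show "b' (x + y) z = b' x z + b' y z" if "y \<in> V'"
    using x z that by (simp add: b'_def V'D form_add sum.distrib)
  show "b' x x > 0" if "x \<noteq> 0"
  proof -
    have "\<exists>i. block i x \<noteq> 0"
      using that V'D(4)[OF x] by (metis eq_if_blocks_eq block_simps(1) zero_fun_apply)
    then obtain i where "block i x \<noteq> 0" ..
    then show ?thesis
      unfolding b'_def using x
      by (intro sum_pos2[of UNIV i]) (auto simp: V'D intro: form_nonneg form_pos)
  qed
  show "P' i x \<in> V'" for i
    using x by (intro lift_in) (auto simp: V'D)
  show "P' i (P' i x) = P' i x" for i
    using x by (simp add: block_lift_same V'D)
  show "P' i (x + z) = P' i x + P' i z" for i
  proof (rule eq_if_blocks_eq)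
    show "P' i (x + z) [] = (P' i x + P' i z) []"
      by (simp add: lift_def)
    show "block j (P' i (x + z)) = block j (P' i x + P' i z)" for j
      using x z by (simp add: block_lift V'D P_add algebra_simps)
  qed
  show "P' i (r *\<^sub>R x) = r *\<^sub>R P' i x" for i
  proof (rule eq_if_blocks_eq)
    show "P' i (r *\<^sub>R x) [] = (r *\<^sub>R P' i x) []"
      by (simp add: lift_def scaleR_fun_apply)
    show "block j (P' i (r *\<^sub>R x)) = block j (r *\<^sub>R P' i x)" for j
      using x by (simp add: block_lift V'D P_scaleR algebra_simps)
  qed
  show "b' (P' i x) z = b' x (P' i z)" for i
  proof -
    have "b' x (P' i z) = b' (P' i z) x"
      unfolding b'_def using x z by (intro sum.cong form_commute) (auto simp: V'D intro!: V'D lift_in)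
    then show ?thesis
      using x z by (simp add: form_lift V'D form_commute)
  qed
  show "(\<Sum>i\<in>UNIV. P' i x) = (\<alpha> / (\<alpha> - 1)) *\<^sub>R x"
  proof (rule eq_if_blocks_eq)
    show "(\<Sum>i\<in>UNIV. P' i x) [] = ((\<alpha> / (\<alpha> - 1)) *\<^sub>R x) []"
      using V'D(4)[OF x] by (simp add: sum_fun_apply scaleR_fun_apply lift_def)
    fix j
    have "(\<Sum>i\<in>UNIV. P j (block i x)) = 0"
      using P_sum_right[of UNIV "\<lambda>i. block i x" j] x by (simp add: V'D)
    then show "block j (\<Sum>i\<in>UNIV. P' i x) = block j ((\<alpha> / (\<alpha> - 1)) *\<^sub>R x)"
      by (simp add: block_lift sum_subtractf flip: scaleR_sum_right)
  qed
qed

text \<open>The blocks of an invariant subspace of the reflected family span an invariant subspace of the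
original one: solving the definition of \<open>lift\<close> for \<open>P\<^sub>j\<close> expresses \<open>P\<^sub>j (block i x)\<close> by blocks of \<open>x\<close> and
of \<open>P'\<^sub>i x\<close>.\<close>
lemma has_finite_invariant_reflected:
  assumes "projection_family.has_finite_invariant V' P'"
  shows has_finite_invariant
proof -
  interpret R: projection_family "\<alpha> / (\<alpha> - 1)" V' b' P'
    by (rule reflected)
  obtain E where E: "finite E" "E \<subseteq> V'" "\<not> E \<subseteq> {0}" "\<And>i. P' i ` E \<subseteq> span E"
    using assms unfolding R.has_finite_invariant_def by blast
  define E' where "E' = (\<Union>i. block i ` E)"
  have block_span: "block j y \<in> span E'" if "y \<in> span E" for j y
    using that span_mono[of "block j ` E" E'] linear_span_image[OF linear_block[of j], of E]
    by (auto simp: E'_def)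
  have "P j (block i x) \<in> span E'" if x: "x \<in> E" for i j x
  proof -
    have "P j (block i x) = (if j = i then \<alpha> *\<^sub>R block i x else 0) - (\<alpha> - 1) *\<^sub>R block j (P' i x)"
      using alpha by (simp add: block_lift)
    also have "\<dots> \<in> span E'"
      using x E(4) by (intro span_diff span_scale block_span) (auto simp: span_0 E'_def intro: span_base span_scale)
    finally show ?thesis .
  qed
  moreover have "\<not> E' \<subseteq> {0}"
  proof
    assume *: "E' \<subseteq> {0}"
    have "x = 0" if x: "x \<in> E" for x
    proof (rule eq_if_blocks_eq)
      show "x [] = 0 []"
        using V'D(4)[of x] x E(2) by auto
      show "block i x = block i 0" for i
        using * x by (auto simp: E'_def)
    qed
    then show False
      using E(3) by blast
  qed
  moreover have "E' \<subseteq> V" "finite E'"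
    using E(1,2) by (auto simp: E'_def V'D)
  ultimately show ?thesis
    unfolding has_finite_invariant_def by (intro exI[of _ E']) (auto simp: E'_def)
qed

end

section \<open>The discrete spectrum\<close>

text \<open>The bound 2 keeps the denominator \<open>n - 1 - x\<close> greater than 1 for \<open>n \<ge> 4\<close>.  So no step divides by
zero, and each step leads to a value greater than 1, to which the reflection applies.\<close>
lemma spectrum_step_orbit:
  assumes "n \<ge> 4" "x = 0 \<or> x = 1"
  shows "0 \<le> (spectrum_step n ^^ k) x \<and> (spectrum_step n ^^ k) x < 2"
proof (induction k)
  case 0
  then show ?case using assms(2) by auto
next
  case (Suc k)
  then have "real n - 1 - (spectrum_step n ^^ k) x > 1"
    using assms(1) by linarith
  then have "0 \<le> spectrum_step n ((spectrum_step n ^^ k) x) \<and> spectrum_step n ((spectrum_step n ^^ k) x) < 2"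
    unfolding spectrum_step_def[of n "(spectrum_step n ^^ k) x"] by simp
  then show ?case
    by simp
qed

text \<open>One step back along the orbit is a reflection followed by a complement, since
\<open>\<alpha> / (\<alpha> - 1) = n - y\<close> for \<open>\<alpha> = spectrum_step n y\<close>.\<close>
lemma has_finite_invariant_orbit_words:
  fixes V :: "('n::finite list \<Rightarrow> 'a::real_vector) set" and P :: "'n \<Rightarrow> _"
  assumes "CARD('n) \<ge> 4" "x = 0 \<or> x = 1"
    and "projection_family ((spectrum_step CARD('n) ^^ k) x) V b P"
  shows "projection_family.has_finite_invariant V P"
  using assms(3)
proof (induction k arbitrary: V b P)
  case 0
  then interpret projection_family x V b P
    by simp
  show ?case
    using assms(2) has_finite_invariant_0 has_finite_invariant_1 by blast
next
  case (Suc k)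
  define y where "y = (spectrum_step CARD('n) ^^ k) x"
  define \<alpha> where "\<alpha> = spectrum_step CARD('n) y"
  have y: "real CARD('n) - 1 - y > 1"
    using spectrum_step_orbit[OF assms(1,2), of k] assms(1) unfolding y_def by linarith
  then have step: "\<alpha> > 1" "\<alpha> / (\<alpha> - 1) = real CARD('n) - y"
    by (simp_all add: \<alpha>_def spectrum_step_def field_simps)
  interpret projection_family \<alpha> V b P
    using Suc.prems by (simp add: \<alpha>_def y_def)
  interpret reflection \<alpha> V b P
    by unfold_locales (use step in auto)
  interpret R: projection_family "real CARD('n) - y" V' b' P'
    using reflected step(2) by simp
  have "projection_family y V' b' (\<lambda>i v. v - P' i v)"
    using R.complement by simp
  then have "projection_family.has_finite_invariant V' (\<lambda>i v. v - P' i v)"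
    unfolding y_def by (rule Suc.IH)
  then show ?case
    by (intro has_finite_invariant_reflected R.has_finite_invariant_complement)
qed

context projection_family
begin

text \<open>Words of length zero carry a copy of any given space, which makes the induction over functions on
words available for it.\<close>
definition embed :: "'v \<Rightarrow> 'n list \<Rightarrow> 'v" where
  "embed x = (\<lambda>w. if w = [] then x else 0)"

lemma embed_Nil [simp]: "embed x [] = x"
  by (simp add: embed_def)

lemma linear_embed: "linear embed"
  by (rule linearI) (auto simp: embed_def scaleR_fun_apply)

lemma embedded:
  "projection_family \<alpha> (embed ` V) (\<lambda>x y. b (x []) (y [])) (\<lambda>i x. embed (P i (x [])))"
proof
  show "subspace (embed ` V)"
    by (rule linear_subspace_image[OF linear_embed subspace_V])
  show "embed ` V \<noteq> {0}"
  proof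
    assume *: "embed ` V = {0}"
    have "x = 0" if "x \<in> V" for x
      using that * embed_Nil[of x] by (metis image_eqI singletonD zero_fun_apply)
    then show False
      using nonzero V_0 by blast
  qed
  show "b (x []) (x []) > 0" if "x \<in> embed ` V" "x \<noteq> 0" for x
    using that linear_0[OF linear_embed] by (auto intro!: form_pos)
  show "b (x []) (y []) = b (y []) (x [])" if "x \<in> embed ` V" "y \<in> embed ` V" for x y
    using that by (auto intro: form_commute)
qed (auto simp: form_add form_scaleR P_in P_add P_scaleR P_idem P_selfadjoint P_sum
    linear_add[OF linear_embed] linear_scale[OF linear_embed] scaleR_fun_apply
    simp flip: linear_sum[OF linear_embed])

lemma has_finite_invariant_orbit:
  assumes "CARD('n) \<ge> 4" "x = 0 \<or> x = 1" "\<alpha> = (spectrum_step CARD('n) ^^ k) x"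
  shows has_finite_invariant
proof -
  interpret E: projection_family \<alpha> "embed ` V" "\<lambda>x y. b (x []) (y [])" "\<lambda>i x. embed (P i (x []))"
    by (rule embedded)
  have E.has_finite_invariant
    using embedded assms(3) by (intro has_finite_invariant_orbit_words[OF assms(1,2)]) blast
  then obtain E where E: "finite E" "E \<subseteq> embed ` V" "\<not> E \<subseteq> {0}"
    "\<And>i. (\<lambda>x. embed (P i (x []))) ` E \<subseteq> span E"
    unfolding E.has_finite_invariant_def by blast
  obtain D where D: "D \<subseteq> V" "E = embed ` D" "finite D"
    using finite_subset_image[OF E(1,2)] by blast
  have "P i x \<in> span D" if "x \<in> D" for i x
  proof -
    have "embed (P i (embed x [])) \<in> span (embed ` D)"
      using E(4)[of i] that unfolding D(2) by blast
    then obtain y where "y \<in> span D" "embed (P i x) = embed y"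
      unfolding linear_span_image[OF linear_embed] embed_Nil by blast
    then show ?thesis
      by (metis embed_Nil)
  qed
  then have "P i ` D \<subseteq> span D" for i
    by blast
  moreover have "\<not> D \<subseteq> {0}"
    using E(3) linear_0[OF linear_embed] by (auto simp: D(2))
  ultimately show ?thesis
    unfolding has_finite_invariant_def using D by blast
qed

lemma has_finite_invariant_discrete_spectrum:
  assumes "CARD('n) \<ge> 4" "\<alpha> \<in> discrete_spectrum CARD('n)"
  shows has_finite_invariant
proof -
  consider k x where "x = 0 \<or> x = 1" "\<alpha> = (spectrum_step CARD('n) ^^ k) x"
    | k x where "x = 0 \<or> x = 1" "real CARD('n) - \<alpha> = (spectrum_step CARD('n) ^^ k) x"
    using assms(2) unfolding discrete_spectrum_def Lambda0_def Lambda1_def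
    by (smt (verit, best) UnE imageE rangeE)
  then show ?thesis
  proof cases
    case 1
    then show ?thesis
      using has_finite_invariant_orbit assms(1) by blast
  next
    case 2
    interpret C: projection_family "real CARD('n) - \<alpha>" V b "\<lambda>i x. x - P i x"
      by (rule complement)
    show ?thesis
      using C.has_finite_invariant_orbit[OF assms(1) 2] by (rule has_finite_invariant_complement)
  qed
qed

end

section \<open>Finite-dimensional subspaces\<close>

definition re_inner :: "'a::chilbert_space \<Rightarrow> 'a \<Rightarrow> real" where
  "re_inner x y = Re (cinner x y)"

lemma re_inner_commute: "re_inner x y = re_inner y x"
  unfolding re_inner_def by (subst cinner_commute) simp

lemma re_inner_self: "re_inner x x = (norm x)\<^sup>2"
  by (simp add: re_inner_def cinner_self)

lemma re_inner_add_left: "re_inner (x + y) z = re_inner x z + re_inner y z"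
  by (simp add: re_inner_def cinner_add_left)

lemma re_inner_scaleR_left: "re_inner (r *\<^sub>R x) y = r * re_inner x y"
  by (simp add: re_inner_def cinner_scaleC_left flip: scaleC_of_real)

lemma linear_re_inner_left: "linear (\<lambda>x. re_inner x y)"
  by (rule linearI) (auto simp: re_inner_add_left re_inner_scaleR_left)

lemma linear_re_inner_right: "linear (re_inner x)"
proof -
  have "re_inner x = (\<lambda>y. re_inner y x)"
    by (rule ext) (rule re_inner_commute)
  then show ?thesis
    using linear_re_inner_left by metis
qed

lemmas re_inner_linear [simp] =
  linear_0[OF linear_re_inner_left] linear_0[OF linear_re_inner_right]
  linear_add[OF linear_re_inner_left] linear_add[OF linear_re_inner_right]
  linear_diff[OF linear_re_inner_left] linear_diff[OF linear_re_inner_right]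
  linear_cmul[OF linear_re_inner_left] linear_cmul[OF linear_re_inner_right]
  linear_sum[OF linear_re_inner_left] linear_sum[OF linear_re_inner_right]

lemma re_inner_polarization: "re_inner x y = ((norm (x + y))\<^sup>2 - (norm (x - y))\<^sup>2) / 4"
  by (simp add: re_inner_commute[of y x] flip: re_inner_self)

text \<open>Hence a complex-linear map that preserves the real inner product preserves the complex one.\<close>
lemma cinner_eq_re_inner: "cinner x y = Complex (re_inner x y) (re_inner x (\<i> *\<^sub>C y))"
  by (simp add: re_inner_def cinner_scaleC_right complex_eq_iff)

lemma continuous_re_inner_left: "continuous_on S (\<lambda>x. re_inner x y)"
  unfolding re_inner_polarization by (intro continuous_intros) auto

definition orthonormal :: "'a::chilbert_space set \<Rightarrow> bool" where
  "orthonormal E \<longleftrightarrow> (\<forall>e\<in>E. \<forall>f\<in>E. re_inner e f = (if e = f then 1 else 0))"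

lemma orthonormal_expansion:
  assumes "finite E" "orthonormal E" "x \<in> span E"
  shows "(\<Sum>e\<in>E. re_inner x e *\<^sub>R e) = x"
proof -
  obtain u where u: "x = (\<Sum>e\<in>E. u e *\<^sub>R e)"
    using assms(3) by (auto simp: span_finite[OF assms(1)])
  have "re_inner x f = u f" if "f \<in> E" for f
  proof -
    have "re_inner x f = (\<Sum>e\<in>E. if e = f then u e else 0)"
      unfolding u using assms(2) that by (auto simp: orthonormal_def intro!: sum.cong)
    then show ?thesis
      using that assms(1) by simp
  qed
  then show ?thesis
    using u by simp
qed

lemma Gram_Schmidt:
  fixes B :: "'a::chilbert_space set"
  assumes "finite B"
  shows "\<exists>E. finite E \<and> orthonormal E \<and> span E = span B"
  using assms
proof (induction B)
  case empty
  show ?case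
    by (intro exI[of _ "{}"]) (auto simp: orthonormal_def)
next
  case (insert a B)
  then obtain E where E: "finite E" "orthonormal E" "span E = span B"
    by blast
  define p where "p = (\<Sum>e\<in>E. re_inner a e *\<^sub>R e)"
  have p: "p \<in> span E"
    unfolding p_def by (intro span_sum span_scale span_base)
  have orth: "re_inner (a - p) f = 0" if "f \<in> E" for f
  proof -
    have "re_inner p f = (\<Sum>e\<in>E. if e = f then re_inner a e else 0)"
      unfolding p_def using E(2) that by (auto simp: orthonormal_def intro!: sum.cong)
    then show ?thesis
      using that E(1) by simp
  qed
  show ?case
  proof (cases "a = p")
    case True
    then have "span (insert a B) = span B"
      using p E(3) by (simp add: span_redundant)
    then show ?thesis
      using E by blast
  next
    case False
    define e where "e = (1 / norm (a - p)) *\<^sub>R (a - p)"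
    have "re_inner e f = 0" "re_inner f e = 0" if "f \<in> E" for f
      unfolding re_inner_commute[of f e]
      unfolding e_def using orth[OF that] by (simp_all only: re_inner_scaleR_left)
    moreover have "re_inner e e = 1"
      using False by (simp add: re_inner_self e_def)
    ultimately have "orthonormal (insert e E)"
      using E(2) by (fastforce simp: orthonormal_def)
    moreover have "span (insert e E) = span (insert a B)"
    proof -
      have "span (insert (a - p) E) = span (insert a E)"
        by (rule eq_span_insert_eq) (simp add: p span_neg)
      moreover have "span (insert e E) = span (insert (a - p) E)"
      proof
        have "e \<in> span (insert (a - p) E)"
          unfolding e_def by (intro span_scale span_base) simp
        then show "span (insert e E) \<subseteq> span (insert (a - p) E)"
          by (intro span_minimal) (auto simp: span_base)
        have "norm (a - p) *\<^sub>R e \<in> span (insert e E)"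
          by (intro span_scale span_base) simp
        then have "a - p \<in> span (insert e E)"
          using False by (simp add: e_def)
        then show "span (insert (a - p) E) \<subseteq> span (insert e E)"
          by (intro span_minimal) (auto simp: span_base)
      qed
      moreover have "span (insert a E) = span (insert a B)"
        using E(3) by (simp add: span_insert)
      ultimately show ?thesis
        by simp
    qed
    ultimately show ?thesis
      using E(1) by (intro exI[of _ "insert e E"]) simp
  qed
qed

lemma orthonormal_basis_of_subspace:
  fixes M :: "'a::chilbert_space set"
  assumes "finite B" "subspace M" "M \<subseteq> span B"
  obtains E where "finite E" "orthonormal E" "span E = M"
proof -
  obtain C where C: "C \<subseteq> M" "independent C" "M \<subseteq> span C"
    using maximal_independent_subset[of M] by blast
  have "finite C"
    using independent_span_bound[of B C] assms C by auto
  then obtain E where "finite E" "orthonormal E" "span E = span C"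
    using Gram_Schmidt by blast
  moreover have "span C = M"
    using C assms(2) by (simp add: span_minimal subset_antisym)
  ultimately show thesis
    using that by blast
qed

text \<open>In terms of an orthonormal basis the subspace is the set of fixed points of a continuous map.\<close>
lemma closed_finite_dimensional_subspace:
  fixes M :: "'a::chilbert_space set"
  assumes "finite B" "subspace M" "M \<subseteq> span B"
  shows "closed M"
proof -
  obtain E where E: "finite E" "orthonormal E" "span E = M"
    using orthonormal_basis_of_subspace[OF assms] .
  have "x \<in> M" if "(\<Sum>e\<in>E. re_inner x e *\<^sub>R e) = x" for x
    by (subst that[symmetric]) (auto simp flip: E(3) intro: span_sum span_scale span_base)
  then have "M = {x. (\<Sum>e\<in>E. re_inner x e *\<^sub>R e) = x}"
    using orthonormal_expansion[OF E(1,2)] E(3) by blast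
  also have "closed \<dots>"
    by (intro closed_Collect_eq continuous_intros continuous_re_inner_left)
  finally show ?thesis .
qed

section \<open>Complex-linear maps and eigenvectors\<close>

definition clinear_on ::
    "'a::chilbert_space set \<Rightarrow> 'b::chilbert_space set \<Rightarrow> ('a \<Rightarrow> 'b) \<Rightarrow> bool" where
  "clinear_on H K A \<longleftrightarrow> A ` H \<subseteq> K \<and> (\<forall>x\<in>H. \<forall>y\<in>H. A (x + y) = A x + A y) \<and>
     (\<forall>c. \<forall>x\<in>H. A (c *\<^sub>C x) = c *\<^sub>C A x)"

lemma clinear_onD:
  assumes "clinear_on H K A"
  shows "x \<in> H \<Longrightarrow> A x \<in> K" "\<lbrakk>x \<in> H; y \<in> H\<rbrakk> \<Longrightarrow> A (x + y) = A x + A y"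
    "x \<in> H \<Longrightarrow> A (c *\<^sub>C x) = c *\<^sub>C A x" "x \<in> H \<Longrightarrow> A (r *\<^sub>R x) = r *\<^sub>R A x"
  using assms by (auto simp: clinear_on_def simp flip: scaleC_of_real)

lemma clinear_on_0: "\<lbrakk>clinear_on H K A; 0 \<in> H\<rbrakk> \<Longrightarrow> A 0 = 0"
  using clinear_onD(4)[of H K A 0 0] by simp

lemma clinear_on_sum:
  assumes "clinear_on H K A" "csubspace H" "\<And>s. s \<in> S \<Longrightarrow> f s \<in> H"
  shows "A (\<Sum>s\<in>S. f s) = (\<Sum>s\<in>S. A (f s))"
  using assms(3) by (induction S rule: infinite_finite_induct)
    (auto simp: clinear_on_0[OF assms(1)] csubspaceD[OF assms(2)] clinear_onD[OF assms(1)]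
      csubspace_sum[OF assms(2)])

lemma scaleC_complex_eq: "c *\<^sub>C x = Re c *\<^sub>R x + Im c *\<^sub>R (\<i> *\<^sub>C x)"
proof -
  have "c *\<^sub>C x = (complex_of_real (Re c) + complex_of_real (Im c) * \<i>) *\<^sub>C x"
    by (metis complex_eq mult.commute)
  then show ?thesis
    unfolding scaleC_add_left by (simp only: scaleC_of_real flip: scaleC_scaleC)
qed

lemma scaleC_minus_left: "(- c) *\<^sub>C x = - (c *\<^sub>C x)"
  using scaleC_complex_eq[of "- c" x] scaleC_complex_eq[of c x] by simp

lemma subspace_if_csubspace: "csubspace M \<Longrightarrow> subspace M"
  by (auto simp: subspace_def intro: csubspaceD)

text \<open>This is \<open>p(A) x\<close>, written as a Horner scheme with the vectors \<open>a x\<close> in place of the coefficients \<open>a\<close>.\<close>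
definition poly_op :: "('a::chilbert_space \<Rightarrow> 'a) \<Rightarrow> complex poly \<Rightarrow> 'a \<Rightarrow> 'a" where
  "poly_op A p x = fold_coeffs (\<lambda>a v. a *\<^sub>C x + A v) p 0"

text \<open>In finite dimension \<open>p(A) x = 0\<close> for some nonzero polynomial \<open>p\<close>.  If \<open>p\<close> has minimal degree and
\<open>p = (X - z) q\<close>, then \<open>q(A) x\<close> is an eigenvector for \<open>z\<close>.\<close>
lemma ex_eigenvector:
  fixes A :: "'a::chilbert_space \<Rightarrow> 'a"
  assumes H: "csubspace H" "H \<subseteq> span B" "finite B" "H \<noteq> {0}" and A: "clinear_on H H A"
  obtains c y where "y \<in> H" "y \<noteq> 0" "A y = c *\<^sub>C y"
proof -
  note sub = csubspaceD[OF H(1)] and lin = clinear_onD[OF A]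
  obtain x where x: "x \<in> H" "x \<noteq> 0"
    using H(4) sub(1) by blast
  define ev where "ev p = poly_op A p x" for p
  have A0: "A 0 = 0"
    using clinear_on_0[OF A sub(1)] .
  have s0: "0 *\<^sub>C y = 0" for y :: 'a
    using scaleC_of_real[of 0 y] by simp
  have ev_0 [simp]: "ev 0 = 0"
    by (simp add: ev_def poly_op_def)
  have ev_pCons: "ev (pCons a p) = a *\<^sub>C x + A (ev p)" for a p
    by (cases "a = 0 \<and> p = 0") (auto simp: ev_def poly_op_def A0 s0)
  have ev_in: "ev p \<in> H" for p
    by (induction p) (auto simp: ev_pCons sub lin x)
  have ev_add: "ev (p + q) = ev p + ev q" for p q
    by (induction p q rule: poly_induct2)
      (auto simp: ev_pCons sub lin x ev_in scaleC_add_left)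
  have ev_smult: "ev (smult c p) = c *\<^sub>C ev p" for c p
    by (induction p) (auto simp: ev_pCons sub lin x ev_in scaleC_add_right scaleC_scaleC)
  have ev_sum: "ev (\<Sum>s\<in>S. f s) = (\<Sum>s\<in>S. ev (f s))" for f :: "nat \<Rightarrow> complex poly" and S
    by (induction S rule: infinite_finite_induct) (auto simp: ev_add)
  \<comment> \<open>The infinitely many vectors \<open>A\<^sup>k x\<close> cannot be distinct and linearly independent.\<close>
  have "\<exists>p. p \<noteq> 0 \<and> ev p = 0"
  proof -
    define f where "f k = ev (monom 1 k)" for k
    show ?thesis
    proof (cases "inj f")
      case False
      then obtain k l where "f k = f l" "k \<noteq> l"
        by (auto simp: inj_def)
      then have "ev (monom 1 k + smult (- 1) (monom 1 l)) = 0"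
        by (simp add: ev_add ev_smult f_def scaleC_minus_left del: smult_minus_left)
      moreover have "monom 1 k + smult (- 1) (monom 1 l) \<noteq> (0 :: complex poly)"
        using \<open>k \<noteq> l\<close> by (auto simp: poly_eq_iff intro!: exI[of _ k])
      ultimately show ?thesis
        by blast
    next
      case True
      have "range f \<subseteq> span B"
        using ev_in H(2) by (auto simp: f_def)
      then have "\<not> independent (range f)"
        using independent_span_bound[of B "range f"] H(3) range_inj_infinite[OF True] by blast
      then obtain S u v where S: "finite S" "S \<subseteq> range f" "(\<Sum>v\<in>S. u v *\<^sub>R v) = 0" "v \<in> S" "u v \<noteq> 0"
        unfolding dependent_explicit by blast
      obtain T where T: "finite T" "S = f ` T"
        using finite_subset_image[OF S(1,2)] by blast
      define p where "p = (\<Sum>k\<in>T. smult (complex_of_real (u (f k))) (monom 1 k))"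
      have "ev p = (\<Sum>k\<in>T. u (f k) *\<^sub>R f k)"
        unfolding p_def ev_sum by (simp only: ev_smult f_def scaleC_of_real)
      also have "\<dots> = (\<Sum>v\<in>S. u v *\<^sub>R v)"
        unfolding T(2) by (rule sum.reindex_cong[symmetric, of f]) (use True in \<open>auto intro: inj_on_subset\<close>)
      finally have "ev p = 0"
        using S by simp
      moreover obtain k where k: "k \<in> T" "v = f k"
        using S T by blast
      have "coeff p k = (\<Sum>j\<in>T. if j = k then complex_of_real (u (f j)) else 0)"
        unfolding p_def coeff_sum by (intro sum.cong) auto
      then have "coeff p k \<noteq> 0"
        using k S T(1) by simp
      then have "p \<noteq> 0"
        by auto
      ultimately show ?thesis
        by blast
    qed
  qed
  then obtain p where p: "p \<noteq> 0" "ev p = 0" and min: "\<And>q. q \<noteq> 0 \<Longrightarrow> ev q = 0 \<Longrightarrow> degree p \<le> degree q"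
    using ex_has_least_nat[of "\<lambda>p. p \<noteq> 0 \<and> ev p = 0" _ degree] by blast
  have "degree p \<noteq> 0"
  proof
    assume "degree p = 0"
    then obtain c where c: "p = [:c:]"
      by (rule degree_eq_zeroE)
    then have "inverse c *\<^sub>C c *\<^sub>C x = 0"
      using p(2) by (simp add: ev_pCons A0)
    then show False
      using c p(1) x(2) by (simp add: scaleC_scaleC)
  qed
  then obtain z where "poly p z = 0"
    using fundamental_theorem_of_algebra[of p] by (auto simp: constant_degree)
  then obtain q where q: "p = [:- z, 1:] * q"
    by (auto simp: poly_eq_0_iff_dvd)
  with p(1) have "q \<noteq> 0"
    by auto
  then have "degree q < degree p"
    unfolding q by (subst degree_mult_eq) auto
  then have "ev q \<noteq> 0"
    using min[OF \<open>q \<noteq> 0\<close>] by linarith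
  moreover have "ev p = - (z *\<^sub>C ev q) + A (ev q)"
    using q by (simp add: ev_add ev_smult ev_pCons s0 scaleC_minus_left del: smult_minus_left)
  then have "A (ev q) = z *\<^sub>C ev q"
    using p(2) by (simp add: eq_neg_iff_add_eq_0 add.commute)
  ultimately show thesis
    using that ev_in by blast
qed

section \<open>Finite-dimensional irreducible representations\<close>

lemma projection_family_rep:
  assumes "is_rep \<alpha> H P"
  shows "projection_family \<alpha> H re_inner P"
proof
  note facts = rep_facts[OF assms]
  note P = bounded_opsD[OF facts(4)]
  show "subspace H" "H \<noteq> {0}"
    using facts by (auto intro: subspace_if_csubspace)
  show "re_inner (P i x) y = re_inner x (P i y)" if "x \<in> H" "y \<in> H" for i x y
    using facts(7)[OF that] by (simp add: re_inner_def)
  show "P i (r *\<^sub>R x) = r *\<^sub>R P i x" if "x \<in> H" for i r x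
    using P(3)[OF that, of i "complex_of_real r"] by (simp add: scaleC_of_real)
qed (auto simp: re_inner_self rep_facts[OF assms] bounded_opsD(2)[OF rep_facts(4)[OF assms]]
    intro: re_inner_commute)

lemma clinear_on_P:
  assumes "is_rep \<alpha> H P"
  shows "clinear_on H H (P i)"
  using bounded_opsD(1-3)[OF rep_facts(4)[OF assms, of i]] by (auto simp: clinear_on_def)

text \<open>The finite invariant set \<open>E\<close> only yields an invariant real subspace; adjoining \<open>\<i> E\<close> makes it complex,
and being finite-dimensional it is closed, so irreducibility applies to it.\<close>
lemma orthonormal_basis_if_discrete_spectrum:
  fixes P :: "'n::finite \<Rightarrow> 'a::chilbert_space \<Rightarrow> 'a"
  assumes "CARD('n) \<ge> 4" "\<alpha> \<in> discrete_spectrum CARD('n)" "is_rep \<alpha> H P" "irreducible_rep H P"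
  obtains E where "finite E" "orthonormal E" "span E = H"
proof -
  interpret projection_family \<alpha> H re_inner P
    by (rule projection_family_rep[OF assms(3)])
  note facts = rep_facts[OF assms(3)] and lin = clinear_onD[OF clinear_on_P[OF assms(3)]]
  obtain E where E: "finite E" "E \<subseteq> H" "\<not> E \<subseteq> {0}" "\<And>i. P i ` E \<subseteq> span E"
    using has_finite_invariant_discrete_spectrum[OF assms(1,2)]
    unfolding has_finite_invariant_def by blast
  define B where "B = E \<union> scaleC \<i> ` E"
  define M where "M = span B"
  have M: "subspace M" "B \<subseteq> M" "span E \<subseteq> M"
    unfolding M_def B_def by (auto simp: span_base intro: span_mono[THEN subsetD])
  have M_I: "\<i> *\<^sub>C x \<in> M" if "x \<in> M" for x
  proof -
    have "\<i> *\<^sub>C x \<in> M" if "x \<in> B" for x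
    proof -
      have "\<i> *\<^sub>C \<i> *\<^sub>C y = - y" for y :: 'a
        using scaleC_minus_left[of 1 y] by (simp add: scaleC_scaleC)
      then show ?thesis
        using that M by (auto simp: B_def subspace_neg)
    qed
    moreover have "linear (\<lambda>x::'a. \<i> *\<^sub>C x)"
      by (rule linearI) (auto simp: scaleC_add_right scaleC_scaleC mult.commute simp flip: scaleC_of_real)
    ultimately have "scaleC \<i> ` span B \<subseteq> M"
      using span_minimal[of "scaleC \<i> ` B" M] M(1) linear_span_image[of "scaleC \<i>" B] by auto
    then show ?thesis
      using that by (auto simp: M_def)
  qed
  have "csubspace M"
    unfolding csubspace_def
  proof (intro conjI ballI allI)
    fix c x assume "x \<in> M"
    then show "c *\<^sub>C x \<in> M"
      unfolding scaleC_complex_eq[of c] using M(1) M_I by (intro subspace_add subspace_scale) auto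
  qed (use M(1) in \<open>auto simp: subspace_def\<close>)
  moreover have "finite B"
    using E(1) by (simp add: B_def)
  then have "closed M"
    by (rule closed_finite_dimensional_subspace[of B]) (auto simp: M_def)
  moreover have "B \<subseteq> H"
    using E(2) csubspaceD(3)[OF facts(1)] by (auto simp: B_def)
  then have "M \<subseteq> H"
    unfolding M_def by (intro span_minimal subspace_V)
  moreover have "P i ` M \<subseteq> M" for i
  proof -
    have "P i x \<in> M" if "x \<in> E" for x
      using E(4) M(3) that by blast
    then have "B \<subseteq> {x \<in> H. P i x \<in> M}"
      using \<open>B \<subseteq> H\<close> E(2) M_I lin(3) by (auto simp: B_def subset_iff)
    moreover have "subspace {x \<in> H. P i x \<in> M}"
      using M(1) by (auto simp: subspace_def V_0 V_add V_scaleR P_add P_scaleR)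
    ultimately have "M \<subseteq> {x \<in> H. P i x \<in> M}"
      unfolding M_def by (rule span_minimal)
    then show ?thesis
      by blast
  qed
  moreover have "M \<noteq> {0}"
    using E(3) M(2) by (auto simp: B_def)
  ultimately have "M = H"
    using assms(4) unfolding irreducible_rep_def closed_csubspace_def by blast
  then show thesis
    using Gram_Schmidt[OF \<open>finite B\<close>] that unfolding M_def by blast
qed

text \<open>An eigenspace of \<open>A\<close> is invariant under all \<open>P\<^sub>i\<close>.\<close>
lemma Schur:
  assumes rep: "is_rep \<alpha> H P" and irr: "irreducible_rep H P"
    and fin: "finite B" "H \<subseteq> span B"
    and A: "clinear_on H H A" and comm: "\<And>i x. x \<in> H \<Longrightarrow> A (P i x) = P i (A x)"
  obtains c where "\<And>x. x \<in> H \<Longrightarrow> A x = c *\<^sub>C x"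
proof -
  note facts = rep_facts[OF rep] and lin = clinear_onD[OF A]
    and P = clinear_onD[OF clinear_on_P[OF rep]]
  note sub = csubspaceD[OF facts(1)]
  obtain c y where y: "y \<in> H" "y \<noteq> 0" "A y = c *\<^sub>C y"
    using ex_eigenvector[OF facts(1) fin(2,1) facts(3) A] .
  define M where "M = {x \<in> H. A x = c *\<^sub>C x}"
  have M: "csubspace M"
    by (auto simp: csubspace_def M_def sub lin clinear_on_0[OF A] scaleC_add_right scaleC_scaleC
        mult.commute)
  moreover have "closed M"
    using fin subspace_if_csubspace[OF M] by (intro closed_finite_dimensional_subspace[of B])
      (auto simp: M_def)
  moreover have "P i ` M \<subseteq> M" for i
    by (auto simp: M_def P comm)
  moreover have "M \<subseteq> H" "M \<noteq> {0}"
    using y by (auto simp: M_def)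
  ultimately have "M = H"
    using irr unfolding irreducible_rep_def closed_csubspace_def by blast
  then show thesis
    using that by (auto simp: M_def)
qed

section \<open>Morphisms of systems of kernels\<close>

text \<open>The assumption \<open>ker\<close> says that \<open>A\<close> maps the kernel of \<open>P\<^sub>i\<close> into the kernel of \<open>P'\<^sub>i\<close>, in the form in which
it enters the norm computation.\<close>
locale kernel_morphism =
  fixes \<alpha> \<alpha>' :: real
    and H :: "'a::chilbert_space set" and P :: "'n::finite \<Rightarrow> 'a \<Rightarrow> 'a"
    and H' :: "'b::chilbert_space set" and P' :: "'n \<Rightarrow> 'b \<Rightarrow> 'b"
    and A :: "'a \<Rightarrow> 'b"
  assumes rep: "is_rep \<alpha> H P" and rep': "is_rep \<alpha>' H' P'"
    and lin: "clinear_on H H' A"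
    and ker: "x \<in> H \<Longrightarrow> P' i (A (P i x)) = P' i (A x)"
begin

sublocale dom: projection_family \<alpha> H re_inner P
  by (rule projection_family_rep[OF rep])

sublocale cod: projection_family \<alpha>' H' re_inner P'
  by (rule projection_family_rep[OF rep'])

lemmas A = clinear_onD[OF lin]

lemma A_sum: "(\<And>s. s \<in> S \<Longrightarrow> f s \<in> H) \<Longrightarrow> A (\<Sum>s\<in>S. f s) = (\<Sum>s\<in>S. A (f s))"
  using clinear_on_sum[OF lin rep_facts(1)[OF rep]] .

lemma A_expansion:
  assumes "finite E" "orthonormal E" "span E = H" "x \<in> H"
  shows "A x = (\<Sum>e\<in>E. re_inner x e *\<^sub>R A e)"
proof -
  have E: "e \<in> H" if "e \<in> E" for e
    using that assms(3) by (auto simp: span_base)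
  have "A x = A (\<Sum>e\<in>E. re_inner x e *\<^sub>R e)"
    using orthonormal_expansion[OF assms(1,2)] assms(3,4) by simp
  then show ?thesis
    using E by (simp add: A_sum A dom.V_scaleR)
qed

text \<open>This is the trace identity \<open>tr (P\<^sub>i A\<^sup>* A P\<^sub>i) = tr (A\<^sup>* A P\<^sub>i)\<close>, proved by expanding in the basis \<open>E\<close> and
exchanging the order of summation.\<close>
lemma sum_inner_A_P:
  assumes E: "finite E" "orthonormal E" "span E = H"
  shows "(\<Sum>e\<in>E. re_inner (A (P i e)) (A (P i e))) = (\<Sum>e\<in>E. re_inner (A (P i e)) (A e))"
proof -
  have EH: "e \<in> H" if "e \<in> E" for e
    using that E(3) by (auto simp: span_base)
  note exp = A_expansion[OF E]
  have "(\<Sum>e\<in>E. re_inner (A (P i e)) (A (P i e))) =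
      (\<Sum>e\<in>E. \<Sum>f\<in>E. re_inner (P i e) f * re_inner (A (P i e)) (A f))"
    by (intro sum.cong refl, subst (2) exp) (auto simp: EH dom.P_in)
  also have "\<dots> = (\<Sum>f\<in>E. \<Sum>e\<in>E. re_inner (P i f) e * re_inner (A (P i e)) (A f))"
  proof (subst sum.swap, intro sum.cong refl)
    fix e f assume "e \<in> E" "f \<in> E"
    then have "re_inner (P i f) e = re_inner (P i e) f"
      by (metis EH dom.P_selfadjoint re_inner_commute)
    then show "re_inner (P i f) e * re_inner (A (P i f)) (A e) =
        re_inner (P i e) f * re_inner (A (P i f)) (A e)"
      by simp
  qed
  also have "\<dots> = (\<Sum>f\<in>E. re_inner (A (P i (P i f))) (A f))"
  proof (intro sum.cong refl)
    fix f assume f: "f \<in> E"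
    have "P i (P i f) = P i (\<Sum>e\<in>E. re_inner (P i f) e *\<^sub>R e)"
      using orthonormal_expansion[OF E(1,2)] f E(3) by (simp add: EH dom.P_in)
    also have "\<dots> = (\<Sum>e\<in>E. re_inner (P i f) e *\<^sub>R P i e)"
      by (simp add: dom.P_sum_right dom.V_scaleR dom.P_scaleR EH)
    finally have "A (P i (P i f)) = (\<Sum>e\<in>E. re_inner (P i f) e *\<^sub>R A (P i e))"
      by (simp add: A_sum A dom.V_scaleR dom.P_in EH)
    then show "(\<Sum>e\<in>E. re_inner (P i f) e * re_inner (A (P i e)) (A f)) =
        re_inner (A (P i (P i f))) (A f)"
      by simp
  qed
  also have "\<dots> = (\<Sum>e\<in>E. re_inner (A (P i e)) (A e))"
    by (simp add: dom.P_idem EH)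
  finally show ?thesis .
qed

text \<open>Orthogonality of the projection \<open>P'\<^sub>i\<close> gives
\<open>\<parallel>A P\<^sub>i e - P'\<^sub>i A P\<^sub>i e\<parallel>\<^sup>2 = \<parallel>A P\<^sub>i e\<parallel>\<^sup>2 - \<parallel>P'\<^sub>i A P\<^sub>i e\<parallel>\<^sup>2\<close>, where \<open>P'\<^sub>i A P\<^sub>i = P'\<^sub>i A\<close>.  Summed over the basis and
over \<open>i\<close>, the first term gives \<open>\<alpha>\<close> times and the second one \<open>\<alpha>'\<close> times the squared
Hilbert-Schmidt norm of \<open>A\<close>.\<close>
lemma defect:
  assumes E: "finite E" "orthonormal E" "span E = H"
  shows "(\<Sum>i\<in>UNIV. \<Sum>e\<in>E. (norm (A (P i e) - P' i (A e)))\<^sup>2) = (\<alpha> - \<alpha>') * (\<Sum>e\<in>E. (norm (A e))\<^sup>2)"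
proof -
  have EH: "e \<in> H" if "e \<in> E" for e
    using that E(3) by (auto simp: span_base)
  have "(norm (A (P i e) - P' i (A e)))\<^sup>2 =
      re_inner (A (P i e)) (A (P i e)) - re_inner (P' i (A e)) (P' i (A e))" if "e \<in> E" for i e
  proof -
    have "re_inner (P' i (A e)) (A (P i e)) = re_inner (P' i (A e)) (P' i (A (P i e)))"
      using EH[OF that] by (metis cod.P_idem cod.P_selfadjoint cod.P_in A(1) dom.P_in)
    then have "re_inner (P' i (A e)) (A (P i e)) = re_inner (P' i (A e)) (P' i (A e))"
      by (simp add: ker EH[OF that])
    then show ?thesis
      by (simp add: re_inner_commute[of "A (P i e)" "P' i (A e)"] flip: re_inner_self)
  qed
  then have "(\<Sum>i\<in>UNIV. \<Sum>e\<in>E. (norm (A (P i e) - P' i (A e)))\<^sup>2) =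
      (\<Sum>i\<in>UNIV. \<Sum>e\<in>E. re_inner (A (P i e)) (A (P i e))) -
      (\<Sum>e\<in>E. \<Sum>i\<in>UNIV. re_inner (P' i (A e)) (P' i (A e)))"
    by (subst (3) sum.swap) (simp add: sum_subtractf)
  also have "(\<Sum>e\<in>E. \<Sum>i\<in>UNIV. re_inner (P' i (A e)) (P' i (A e))) = \<alpha>' * (\<Sum>e\<in>E. (norm (A e))\<^sup>2)"
    by (simp only: cod.sum_form_P A EH sum_distrib_left re_inner_self[of "A _"] cong: sum.cong)
  also have "(\<Sum>i\<in>UNIV. \<Sum>e\<in>E. re_inner (A (P i e)) (A (P i e))) = \<alpha> * (\<Sum>e\<in>E. (norm (A e))\<^sup>2)"
  proof -
    have "(\<Sum>i\<in>UNIV. \<Sum>e\<in>E. re_inner (A (P i e)) (A (P i e))) =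
        (\<Sum>e\<in>E. \<Sum>i\<in>UNIV. re_inner (A (P i e)) (A e))"
      unfolding sum_inner_A_P[OF E] by (rule sum.swap)
    also have "\<dots> = (\<Sum>e\<in>E. re_inner (A (\<Sum>i\<in>UNIV. P i e)) (A e))"
      by (simp add: A_sum dom.P_in EH)
    also have "\<dots> = (\<Sum>e\<in>E. \<alpha> * re_inner (A e) (A e))"
      by (simp add: dom.P_sum EH A)
    finally show ?thesis
      by (simp add: sum_distrib_left re_inner_self)
  qed
  finally show ?thesis
    by (simp add: algebra_simps)
qed

lemma level_le:
  assumes E: "finite E" "orthonormal E" "span E = H" and nz: "x \<in> H" "A x \<noteq> 0"
  shows "\<alpha>' \<le> \<alpha>"
proof -
  have "(\<Sum>e\<in>E. re_inner x e *\<^sub>R A e) \<noteq> 0"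
    using A_expansion[OF E nz(1)] nz(2) by simp
  then obtain e where "e \<in> E" "re_inner x e *\<^sub>R A e \<noteq> 0"
    by (rule sum.not_neutral_contains_not_neutral)
  then have "(\<Sum>e\<in>E. (norm (A e))\<^sup>2) > 0"
    using E(1) by (intro sum_pos2[of E e]) auto
  moreover have "(\<alpha> - \<alpha>') * (\<Sum>e\<in>E. (norm (A e))\<^sup>2) \<ge> 0"
    unfolding defect[OF E, symmetric] by (intro sum_nonneg) auto
  ultimately show ?thesis
    by (simp add: zero_le_mult_iff)
qed

lemma intertwines:
  assumes E: "finite E" "orthonormal E" "span E = H" and "\<alpha>' = \<alpha>" "x \<in> H"
  shows "A (P i x) = P' i (A x)"
proof -
  have EH: "e \<in> H" if "e \<in> E" for e
    using that E(3) by (auto simp: span_base)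
  have "(\<Sum>i\<in>UNIV. \<Sum>e\<in>E. (norm (A (P i e) - P' i (A e)))\<^sup>2) = 0"
    using defect[OF E] assms(4) by simp
  then have "A (P i e) = P' i (A e)" if "e \<in> E" for e
    using that E(1) by (simp add: sum_nonneg_eq_0_iff sum_nonneg)
  moreover have "A (P i x) = (\<Sum>e\<in>E. re_inner x e *\<^sub>R A (P i e))"
  proof -
    have "P i x = P i (\<Sum>e\<in>E. re_inner x e *\<^sub>R e)"
      using orthonormal_expansion[OF E(1,2)] E(3) assms(5) by simp
    then show ?thesis
      by (simp add: dom.P_sum_right dom.V_scaleR dom.P_scaleR EH A_sum A dom.P_in)
  qed
  moreover have "P' i (A x) = (\<Sum>e\<in>E. re_inner x e *\<^sub>R P' i (A e))"
    by (simp add: A_expansion[OF E assms(5)] cod.P_sum_right cod.V_scaleR cod.P_scaleR EH A)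
  ultimately show ?thesis
    by simp
qed

end

section \<open>Invertible intertwiners\<close>
lemma re_inner_scaleC_left: "re_inner (c *\<^sub>C x) y = re_inner x (cnj c *\<^sub>C y)"
  by (simp add: re_inner_def cinner_scaleC_left cinner_scaleC_right)

lemma norm_scaleC: "norm (c *\<^sub>C x) = cmod c * norm (x :: 'a::chilbert_space)"
proof -
  have "complex_of_real ((norm (c *\<^sub>C x))\<^sup>2) = complex_of_real ((cmod c * norm x)\<^sup>2)"
    unfolding cinner_self[symmetric] cinner_scaleC_left cinner_scaleC_right
    using complex_norm_square[of c] by (simp add: cinner_self power_mult_distrib mult_ac)
  then have "(norm (c *\<^sub>C x))\<^sup>2 = (cmod c * norm x)\<^sup>2"
    unfolding of_real_eq_iff .
  then show ?thesis
    by (rule power2_eq_imp_eq) auto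
qed

text \<open>The operator \<open>C = A\<^sup>* A\<close> commutes with all \<open>P\<^sub>i\<close>, so it is a scalar \<open>c\<close> by Schur's lemma.  Hence
\<open>\<parallel>A x\<parallel>\<^sup>2 = Re c \<parallel>x\<parallel>\<^sup>2\<close>, and \<open>A\<close> divided by the square root of \<open>Re c\<close> is unitary.\<close>
lemma unitarily_equivalent_if_intertwiner:
  assumes rep: "is_rep \<alpha> H P" and irr: "irreducible_rep H P"
    and E: "finite E" "orthonormal E" "span E = H"
    and lin: "clinear_on H H' A" and bij: "bij_betw A H H'"
    and inter: "\<And>i x. x \<in> H \<Longrightarrow> A (P i x) = P' i (A x)"
    and rep': "is_rep \<alpha>' H' P'"
  shows "unitarily_equivalent H P H' P'"
proof -
  note sub = csubspaceD[OF rep_facts(1)[OF rep]] and A = clinear_onD[OF lin]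
  interpret dom: projection_family \<alpha> H re_inner P
    by (rule projection_family_rep[OF rep])
  interpret cod: projection_family \<alpha>' H' re_inner P'
    by (rule projection_family_rep[OF rep'])
  have EH: "e \<in> H" if "e \<in> E" for e
    using that E(3) by (auto simp: span_base)
  \<comment> \<open>\<open>A\<^sup>* A\<close>, written in the orthonormal basis\<close>
  define C where "C x = (\<Sum>e\<in>E. re_inner (A x) (A e) *\<^sub>R e)" for x
  have C_in: "C x \<in> H" for x
    unfolding C_def by (intro dom.V_sum dom.V_scaleR EH)
  have C: "re_inner (C x) y = re_inner (A x) (A y)" if "x \<in> H" "y \<in> H" for x y
  proof -
    have "A y = A (\<Sum>e\<in>E. re_inner y e *\<^sub>R e)"
      using orthonormal_expansion[OF E(1,2)] E(3) that by simp
    also have "\<dots> = (\<Sum>e\<in>E. re_inner y e *\<^sub>R A e)"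
      by (simp add: clinear_on_sum[OF lin rep_facts(1)[OF rep]] dom.V_scaleR EH A)
    finally show ?thesis
      by (simp add: C_def re_inner_commute[of _ y] mult.commute)
  qed
  have eqI: "u = v" if "u \<in> H" "v \<in> H" "\<And>y. y \<in> H \<Longrightarrow> re_inner u y = re_inner v y" for u v
  proof -
    have "re_inner (u - v) (u - v) = 0"
      using that(3)[of "u - v"] sub(5)[OF that(1,2)] by (subst re_inner_linear(5)) simp
    then show ?thesis
      by (simp only: re_inner_self) simp
  qed
  have "clinear_on H H C"
    unfolding clinear_on_def
  proof (intro conjI ballI allI)
    show "C ` H \<subseteq> H"
      using C_in by blast
    show "C (x + y) = C x + C y" if "x \<in> H" "y \<in> H" for x y
      using that by (simp add: C_def A scaleR_add_left sum.distrib)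
    show "C (c *\<^sub>C x) = c *\<^sub>C C x" if "x \<in> H" for c x
      by (rule eqI) (simp_all add: C_in sub that C A re_inner_scaleC_left)
  qed
  moreover have "C (P i x) = P i (C x)" if "x \<in> H" for i x
    by (rule eqI) (simp_all add: C_in that C A dom.P_in dom.P_selfadjoint inter cod.P_selfadjoint)
  ultimately obtain c where c: "\<And>x. x \<in> H \<Longrightarrow> C x = c *\<^sub>C x"
    using Schur[OF rep irr E(1)] E(3) by (metis subset_refl)
  define r where "r = Re c"
  have norm_A: "(norm (A x))\<^sup>2 = r * (norm x)\<^sup>2" if "x \<in> H" for x
  proof -
    have "(norm (A x))\<^sup>2 = re_inner (c *\<^sub>C x) x"
      using C[OF that that] c[OF that] by (simp add: re_inner_self)
    then show ?thesis
      by (simp add: re_inner_def cinner_scaleC_left cinner_self r_def)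
  qed
  have "r > 0"
  proof -
    obtain x where x: "x \<in> H" "x \<noteq> 0"
      using dom.nonzero dom.V_0 by blast
    have "A x \<noteq> A 0"
      using bij x dom.V_0 by (auto simp: bij_betw_def inj_on_def)
    then have "(norm (A x))\<^sup>2 > 0"
      using clinear_on_0[OF lin dom.V_0] by simp
    then show ?thesis
      unfolding norm_A[OF x(1)] by (simp add: zero_less_mult_iff)
  qed
  define W where "W = (\<lambda>x\<in>H. (1 / sqrt r) *\<^sub>R A x)"
  have W: "W x = (1 / sqrt r) *\<^sub>R A x" if "x \<in> H" for x
    using that by (simp add: W_def)
  have W_add: "W (x + y) = W x + W y" if "x \<in> H" "y \<in> H" for x y
    using that by (simp add: W sub A scaleR_add_right)
  have W_diff: "W (x - y) = W x - W y" if "x \<in> H" "y \<in> H" for x y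
    using W_add[of "x - y" y] that by (simp add: sub)
  have W_scaleC: "W (c *\<^sub>C x) = c *\<^sub>C W x" if "x \<in> H" for c x
    using that by (simp add: W sub A scaleC_scaleC mult.commute flip: scaleC_of_real)
  have norm_W: "norm (W x) = norm x" if "x \<in> H" for x
  proof -
    have "norm (A x) = sqrt r * norm x"
    proof (rule power2_eq_imp_eq)
      show "(norm (A x))\<^sup>2 = (sqrt r * norm x)\<^sup>2"
        using \<open>r > 0\<close> by (simp add: norm_A[OF that] power_mult_distrib)
    qed (use \<open>r > 0\<close> in auto)
    then show ?thesis
      using \<open>r > 0\<close> by (simp add: W that)
  qed
  have W_inner: "re_inner (W x) (W y) = re_inner x y" if "x \<in> H" "y \<in> H" for x y
    unfolding re_inner_polarization using that
    by (simp add: norm_W sub flip: W_add W_diff)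
  have "cinner (W x) (W y) = cinner x y" if "x \<in> H" "y \<in> H" for x y
    unfolding cinner_eq_re_inner using that by (simp add: W_inner sub flip: W_scaleC)
  moreover have W_image: "W ` H = H'"
  proof
    show "W ` H \<subseteq> H'"
      by (auto simp: W A cod.V_scaleR)
    show "H' \<subseteq> W ` H"
    proof
      fix z assume "z \<in> H'"
      then obtain x where x: "x \<in> H" "z = A x"
        using bij by (auto simp: bij_betw_def)
      then have "z = W (sqrt r *\<^sub>R x)"
        using \<open>r > 0\<close> by (simp add: W sub A)
      then show "z \<in> W ` H"
        using x sub by blast
    qed
  qed
  moreover have "W \<in> bounded_ops H H'"
    unfolding bounded_ops_def
    using W_image W_add W_scaleC norm_W by (auto simp: PiE_def W_def intro!: exI[of _ 1])
  moreover have "W (P i x) = P' i (W x)" if "x \<in> H" for i x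
    using that by (simp add: W dom.P_in inter cod.P_scaleR A)
  ultimately show ?thesis
    unfolding unitarily_equivalent_def unitary_op_def by blast
qed

section \<open>Morphisms of the systems \<open>S_F\<close>\<close>

text \<open>The vectors \<open>(P\<^sub>i y)\<^sub>i\<close> are the values \<open>\<Gamma>\<^sup>* y\<close>, and \<open>P = \<Gamma>\<^sup>* \<Gamma> / \<alpha>\<close> fixes them since \<open>\<Gamma> \<Gamma>\<^sup>* = \<alpha>\<close>.\<close>
lemma sub_S_F_None:
  assumes rep: "is_rep \<alpha> H P" and "\<alpha> \<noteq> 0"
  shows "sub (S_F \<alpha> H P) None = (\<lambda>y. \<chi> i. P i y) ` H"
proof -
  interpret projection_family \<alpha> H re_inner P
    by (rule projection_family_rep[OF rep])
  have mem: "(\<chi> i. P i y) \<in> F_space H P" if "y \<in> H" for y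
    using that by (simp add: F_space_iff[OF rep] P_in P_idem)
  have "F_P \<alpha> H P x \<in> (\<lambda>y. \<chi> i. P i y) ` H" if x: "x \<in> F_space H P" for x
  proof
    have sum: "(\<Sum>j\<in>UNIV. x $ j) \<in> H"
      using x by (intro V_sum) (simp add: F_space_iff[OF rep])
    then show "(1 / \<alpha>) *\<^sub>R (\<Sum>j\<in>UNIV. x $ j) \<in> H"
      by (rule V_scaleR)
    show "F_P \<alpha> H P x = (\<chi> i. P i ((1 / \<alpha>) *\<^sub>R (\<Sum>j\<in>UNIV. x $ j)))"
      unfolding F_P_apply[OF rep x] P_scaleR[OF sum] ..
  qed
  moreover have "(\<chi> i. P i y) \<in> F_P \<alpha> H P ` F_space H P" if y: "y \<in> H" for y
  proof
    show "(\<chi> i. P i y) = F_P \<alpha> H P (\<chi> i. P i y)"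
      using assms(2) y by (simp add: F_P_apply[OF rep mem] P_sum P_scaleR)
  qed (rule mem[OF y])
  ultimately show ?thesis
    by (auto simp: S_F_def)
qed

lemma sub_S_F_Some:
  assumes rep: "is_rep \<alpha> H P"
  shows "sub (S_F \<alpha> H P) (Some i) = {x \<in> F_space H P. \<forall>j. j \<noteq> i \<longrightarrow> x $ j = 0}"
proof -
  have "x = F_Q H P i x" if "x \<in> F_space H P" "\<forall>j. j \<noteq> i \<longrightarrow> x $ j = 0" for x
    using that by (simp add: F_Q_apply(1)[OF rep] vec_eq_iff)
  then show ?thesis
    using F_Q_apply[OF rep] by (auto simp: S_F_def)
qed

locale system_morphism =
  fixes \<alpha> \<alpha>' :: real
    and H :: "'a::chilbert_space set" and P :: "'n::finite \<Rightarrow> 'a \<Rightarrow> 'a"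
    and H' :: "'b::chilbert_space set" and P' :: "'n \<Rightarrow> 'b \<Rightarrow> 'b"
    and R :: "'a ^ 'n \<Rightarrow> 'b ^ 'n"
  assumes rep: "is_rep \<alpha> H P" and rep': "is_rep \<alpha>' H' P'" and nz: "\<alpha> \<noteq> 0" "\<alpha>' \<noteq> 0"
    and lin: "clinear_on (F_space H P) (F_space H' P') R"
    and sub: "R ` sub (S_F \<alpha> H P) k \<subseteq> sub (S_F \<alpha>' H' P') k"
begin

sublocale dom: projection_family \<alpha> H re_inner P
  by (rule projection_family_rep[OF rep])

sublocale cod: projection_family \<alpha>' H' re_inner P'
  by (rule projection_family_rep[OF rep'])

lemmas R = clinear_onD[OF lin]
  and space_sub = csubspaceD[OF csubspace_F_space[OF rep]]

text \<open>With \<open>\<Gamma>\<^sup>* y = (P\<^sub>i y)\<^sub>i\<close> this is \<open>\<Gamma>' R \<Gamma>\<^sup>* y / \<alpha>'\<close>.  Since \<open>R \<Gamma>\<^sup>* y = \<Gamma>'\<^sup>* z\<close> for some \<open>z\<close> and \<open>\<Gamma>' \<Gamma>'\<^sup>* = \<alpha>'\<close>, it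
recovers \<open>z\<close>.\<close>
definition "induced y = (1 / \<alpha>') *\<^sub>R (\<Sum>j\<in>UNIV. R (\<chi> i. P i y) $ j)"

lemma range_in: "y \<in> H \<Longrightarrow> (\<chi> i. P i y) \<in> F_space H P"
  by (simp add: F_space_iff[OF rep] dom.P_in dom.P_idem)

text \<open>\<open>R\<close> is block diagonal because it preserves each of the coordinate subspaces.\<close>
lemma component_eqI:
  assumes x: "x \<in> F_space H P" "y \<in> F_space H P" "x $ i = y $ i"
  shows "R x $ i = R y $ i"
proof -
  define z where "z = x - y"
  have z: "z \<in> F_space H P" "z $ i = 0"
    unfolding z_def using x space_sub by auto
  have "(\<Sum>j\<in>UNIV. F_Q H P j z) = z"
    using z by (simp add: F_Q_apply[OF rep] vec_eq_iff)
  then have "R z = R (\<Sum>j\<in>UNIV. F_Q H P j z)"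
    by simp
  also have "\<dots> = (\<Sum>j\<in>UNIV. R (F_Q H P j z))"
    using z by (intro clinear_on_sum[OF lin csubspace_F_space[OF rep]] F_Q_apply[OF rep])
  also have "\<dots> $ i = (\<Sum>j\<in>UNIV. R (F_Q H P j z) $ i)"
    by simp
  also have "\<dots> = 0"
  proof (intro sum.neutral ballI)
    fix j
    show "R (F_Q H P j z) $ i = 0"
    proof (cases "j = i")
      case True
      then have "F_Q H P j z = 0"
        using z by (simp add: F_Q_apply[OF rep] vec_eq_iff)
      then show ?thesis
        using clinear_on_0[OF lin space_sub(1)] by simp
    next
      case False
      have "F_Q H P j z \<in> sub (S_F \<alpha> H P) (Some j)"
        using z by (simp add: S_F_def)
      then have "R (F_Q H P j z) \<in> sub (S_F \<alpha>' H' P') (Some j)"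
        using sub by blast
      then show ?thesis
        using False by (simp add: sub_S_F_Some[OF rep'])
    qed
  qed
  finally have "R z $ i = 0" .
  moreover have "R x = R z + R y"
    using R(2)[of z y] z x by (simp add: z_def)
  ultimately show ?thesis
    by simp
qed

lemma R_range: "y \<in> H \<Longrightarrow> R (\<chi> i. P i y) = (\<chi> i. P' i (induced y))"
  and induced_in: "y \<in> H \<Longrightarrow> induced y \<in> H'"
proof -
  assume y: "y \<in> H"
  then have "R (\<chi> i. P i y) \<in> sub (S_F \<alpha>' H' P') None"
    using sub[of None] sub_S_F_None[OF rep nz(1)] by blast
  then obtain z where z: "z \<in> H'" "R (\<chi> i. P i y) = (\<chi> i. P' i z)"
    unfolding sub_S_F_None[OF rep' nz(2)] by blast
  then have "induced y = z"
    using nz by (simp add: induced_def cod.P_sum)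
  with z show "R (\<chi> i. P i y) = (\<chi> i. P' i (induced y))" "induced y \<in> H'"
    by auto
qed

text \<open>The \<open>i\<close>-th blocks of \<open>x\<close> and of \<open>\<Gamma>\<^sup>* (x\<^sub>i)\<close> agree, so \<open>R\<close> is determined by the induced operator.\<close>
lemma R_component:
  assumes "x \<in> F_space H P"
  shows "R x $ i = P' i (induced (x $ i))"
proof -
  have x: "x $ i \<in> H" "P i (x $ i) = x $ i"
    using assms by (auto simp: F_space_iff[OF rep])
  then have "R x $ i = R (\<chi> j. P j (x $ i)) $ i"
    using assms by (intro component_eqI range_in) auto
  then show ?thesis
    using R_range[OF x(1)] by simp
qed

sublocale induced: kernel_morphism \<alpha> \<alpha>' H P H' P' induced
proof
  show "clinear_on H H' induced"
    unfolding clinear_on_def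
  proof (intro conjI ballI allI)
    show "induced ` H \<subseteq> H'"
      using induced_in by blast
    show "induced (x + y) = induced x + induced y" if "x \<in> H" "y \<in> H" for x y
    proof -
      have "(\<chi> i. P i (x + y)) = (\<chi> i. P i x) + (\<chi> i. P i y)"
        using that by (simp add: vec_eq_iff dom.P_add)
      then show ?thesis
        using that by (simp add: induced_def R range_in sum.distrib scaleR_add_right)
    qed
    show "induced (c *\<^sub>C x) = c *\<^sub>C induced x" if "x \<in> H" for c x
    proof -
      have "(\<chi> i. P i (c *\<^sub>C x)) = c *\<^sub>C (\<chi> i. P i x)"
        using that clinear_onD(3)[OF clinear_on_P[OF rep]] by (simp add: vec_eq_iff scaleC_vec_def)
      then have "induced (c *\<^sub>C x) = (1 / \<alpha>') *\<^sub>R (\<Sum>j\<in>UNIV. c *\<^sub>C R (\<chi> i. P i x) $ j)"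
        using that by (simp add: induced_def R range_in) (simp add: scaleC_vec_def)
      then show ?thesis
        by (simp add: induced_def scaleC_scaleC mult.commute flip: scaleC_sum_right scaleC_of_real)
    qed
  qed
  show "P' i (induced (P i x)) = P' i (induced x)" if "x \<in> H" for i x
    using R_component[OF range_in[OF that], of i] R_range[OF that] by simp
qed (rule rep rep')+

end

lemma induced_inverse:
  assumes "system_morphism \<alpha> \<alpha>' H P H' P' R" "system_morphism \<alpha>' \<alpha> H' P' H P S"
    and "\<And>x. x \<in> F_space H P \<Longrightarrow> S (R x) = x" and "y \<in> H"
  shows "system_morphism.induced \<alpha> P' S (system_morphism.induced \<alpha>' P R y) = y"
proof -
  interpret R: system_morphism \<alpha> \<alpha>' H P H' P' R by fact
  interpret S: system_morphism \<alpha>' \<alpha> H' P' H P S by fact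
  have "S.induced (R.induced y) = (1 / \<alpha>) *\<^sub>R (\<Sum>j\<in>UNIV. S (R (\<chi> i. P i y)) $ j)"
    by (simp add: S.induced_def R.R_range assms(4))
  also have "\<dots> = y"
    using assms(4) R.nz by (simp add: assms(3) R.range_in R.dom.P_sum)
  finally show ?thesis .
qed

lemma clinear_on_bounded_ops: "T \<in> bounded_ops H K \<Longrightarrow> clinear_on H K T"
  using bounded_opsD(1-3)[of T H K] by (auto simp: clinear_on_def)

section \<open>Transitivity and isomorphism\<close>
lemma transitive_system_S_F:
  fixes P :: "'n::finite \<Rightarrow> 'a::chilbert_space \<Rightarrow> 'a"
  assumes rep: "is_rep \<alpha> H P" and irr: "irreducible_rep H P" and "\<alpha> \<noteq> 0"
    and E: "finite E" "orthonormal E" "span E = H"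
  shows "transitive_system (S_F \<alpha> H P)"
  unfolding transitive_system_def
proof (intro subset_antisym subsetI)
  let ?S = "S_F \<alpha> H P"
  have whole [simp]: "whole ?S = F_space H P"
    by (simp add: S_F_def)
  fix R
  {
    assume "R \<in> End ?S"
    then have R_End: "R \<in> bounded_ops (F_space H P) (F_space H P)"
      "\<And>k. R ` sub ?S k \<subseteq> sub ?S k"
      by (auto simp: End_def)
    interpret system_morphism \<alpha> \<alpha> H P H P R
      by unfold_locales (use rep assms(3) R_End clinear_on_bounded_ops in auto)
    obtain c where c: "\<And>x. x \<in> H \<Longrightarrow> induced x = c *\<^sub>C x"
      using Schur[OF rep irr E(1) _ induced.lin] induced.intertwines[OF E refl] E(3) by blast
    have "R x = c *\<^sub>C x" if "x \<in> F_space H P" for x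
      using that R_component[OF that] clinear_onD(3)[OF clinear_on_P[OF rep]]
      by (simp add: vec_eq_iff scaleC_vec_def c F_space_iff[OF rep])
    moreover have "R \<in> extensional (F_space H P)"
      using R_End(1) by (auto simp: bounded_ops_def PiE_iff)
    ultimately have "R = (\<lambda>x\<in>whole ?S. c *\<^sub>C x)"
      by (intro extensionalityI[of _ "F_space H P"]) auto
    then show "R \<in> range (\<lambda>c. \<lambda>x\<in>whole ?S. c *\<^sub>C x)"
      by blast
  next
    assume "R \<in> range (\<lambda>c. \<lambda>x\<in>whole ?S. c *\<^sub>C x)"
    then obtain c where c: "R = (\<lambda>x\<in>F_space H P. c *\<^sub>C x)"
      by auto
    note space = csubspaceD[OF csubspace_F_space[OF rep]]
    have "R \<in> bounded_ops (F_space H P) (F_space H P)"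
      unfolding bounded_ops_def c
      by (auto simp: space scaleC_add_right scaleC_scaleC mult.commute norm_scaleC)
    moreover have "csubspace (sub ?S k)" "sub ?S k \<subseteq> F_space H P" for k
      using is_subspace_system_S_F[OF rep assms(3)]
      by (auto simp: is_subspace_system_def closed_csubspace_def)
    then have "R ` sub ?S k \<subseteq> sub ?S k" for k
      using csubspaceD(3) by (fastforce simp: c)
    ultimately show "R \<in> End ?S"
      by (simp add: End_def)
  }
qed

text \<open>The induced operators of an isomorphism and of its inverse are inverse to each other.  Both are
nonzero, so \<open>\<alpha>' \<le> \<alpha>\<close> and \<open>\<alpha> \<le> \<alpha>'\<close>; with equality the induced operator is a bijective intertwiner.\<close>
lemma unitarily_equivalent_if_isomorphic_S_F:
  fixes P :: "'n::finite \<Rightarrow> 'a::chilbert_space \<Rightarrow> 'a" and P' :: "'n \<Rightarrow> 'b::chilbert_space \<Rightarrow> 'b"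
  assumes rep: "is_rep \<alpha> H P" and irr: "irreducible_rep H P" and "\<alpha> \<noteq> 0"
    and E: "finite E" "orthonormal E" "span E = H"
    and rep': "is_rep \<alpha>' H' P'" and "\<alpha>' \<noteq> 0"
    and E': "finite E'" "orthonormal E'" "span E' = H'"
    and iso: "S_F \<alpha> H P \<cong>\<^sub>S S_F \<alpha>' H' P'"
  shows "unitarily_equivalent H P H' P'"
proof -
  let ?S = "S_F \<alpha> H P" and ?S' = "S_F \<alpha>' H' P'"
  have whole [simp]: "whole ?S = F_space H P" "whole ?S' = F_space H' P'"
    by (simp_all add: S_F_def)
  obtain R where R: "R \<in> bounded_ops (F_space H P) (F_space H' P')"
    "bij_betw R (F_space H P) (F_space H' P')" "\<And>k. R ` sub ?S k = sub ?S' k"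
    using iso by (auto simp: isomorphic_systems_def)
  note lin = clinear_on_bounded_ops[OF R(1)]
  note space = csubspaceD[OF csubspace_F_space[OF rep]]
  define T where "T = inv_into (F_space H P) R"
  have TR: "T (R x) = x" if "x \<in> F_space H P" for x
    using R(2) that by (simp add: T_def bij_betw_def inv_into_f_f)
  have RT: "R (T y) = y" "T y \<in> F_space H P" if "y \<in> F_space H' P'" for y
    using R(2) that by (auto simp: T_def bij_betw_def f_inv_into_f inv_into_into)
  have linT: "clinear_on (F_space H' P') (F_space H P) T"
    unfolding clinear_on_def
  proof (intro conjI ballI allI)
    show "T ` F_space H' P' \<subseteq> F_space H P"
      using RT by blast
    show "T (x + y) = T x + T y" if "x \<in> F_space H' P'" "y \<in> F_space H' P'" for x y
      using that TR[of "T x + T y"] clinear_onD(2)[OF lin] by (simp add: RT space)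
    show "T (c *\<^sub>C x) = c *\<^sub>C T x" if "x \<in> F_space H' P'" for c x
      using that TR[of "c *\<^sub>C T x"] clinear_onD(3)[OF lin] by (simp add: RT space)
  qed
  have "sub ?S k \<subseteq> F_space H P" for k
    using is_subspace_system_S_F[OF rep assms(3)] by (auto simp: is_subspace_system_def)
  then have "T ` sub ?S' k \<subseteq> sub ?S k" for k
    using TR by (fastforce simp flip: R(3))
  then interpret T: system_morphism \<alpha>' \<alpha> H' P' H P T
    by unfold_locales (use assms linT in auto)
  interpret R: system_morphism \<alpha> \<alpha>' H P H' P' R
    by unfold_locales (use assms lin R(3) in auto)
  have ind: "T.induced (R.induced y) = y" if "y \<in> H" for y
    using induced_inverse[OF R.system_morphism_axioms T.system_morphism_axioms TR that] .
  have ind': "R.induced (T.induced y) = y" if "y \<in> H'" for y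
    using induced_inverse[OF T.system_morphism_axioms R.system_morphism_axioms RT(1) that] .
  have bij: "bij_betw R.induced H H'"
    by (rule bij_betw_byWitness[of _ T.induced]) (use ind ind' R.induced_in T.induced_in in auto)
  obtain y where y: "y \<in> H" "y \<noteq> 0"
    using rep_facts(3)[OF rep] csubspaceD(1)[OF rep_facts(1)[OF rep]] by blast
  then have "R.induced y \<noteq> 0"
    using ind[OF y(1)] clinear_on_0[OF T.induced.lin] csubspaceD(1)[OF rep_facts(1)[OF rep']] by auto
  then have "\<alpha>' \<le> \<alpha>" "\<alpha> \<le> \<alpha>'"
    using R.induced.level_le[OF E y(1)] T.induced.level_le[OF E' R.induced_in[OF y(1)]] ind y
    by auto
  then have "R.induced (P i x) = P' i (R.induced x)" if "x \<in> H" for i x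
    using R.induced.intertwines[OF E _ that] by simp
  then show ?thesis
    using unitarily_equivalent_if_intertwiner[OF rep irr E R.induced.lin bij _ rep'] by blast
qed

theorem theorem4:
  assumes "CARD('n::finite) \<ge> 4"
  shows "(\<forall>\<alpha> (H :: 'a::chilbert_space set) (P :: 'n \<Rightarrow> 'a \<Rightarrow> 'a).
            \<alpha> \<in> discrete_spectrum CARD('n) - {0} \<and> is_rep \<alpha> H P \<and> irreducible_rep H P
            \<longrightarrow> transitive_system (S_F \<alpha> H P))
       \<and> (\<forall>\<alpha> \<alpha>' (H :: 'a set) (P :: 'n \<Rightarrow> 'a \<Rightarrow> 'a)
            (H' :: 'b::chilbert_space set) (P' :: 'n \<Rightarrow> 'b \<Rightarrow> 'b).
            \<alpha> \<in> discrete_spectrum CARD('n) - {0} \<and> is_rep \<alpha> H P \<and> irreducible_rep H P \<and>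
            \<alpha>' \<in> discrete_spectrum CARD('n) - {0} \<and> is_rep \<alpha>' H' P' \<and> irreducible_rep H' P' \<and>
            \<not> unitarily_equivalent H P H' P'
            \<longrightarrow> \<not> S_F \<alpha> H P \<cong>\<^sub>S S_F \<alpha>' H' P')"
proof (intro conjI allI impI)
  fix \<alpha> and H :: "'a set" and P :: "'n \<Rightarrow> 'a \<Rightarrow> 'a"
  assume *: "\<alpha> \<in> discrete_spectrum CARD('n) - {0} \<and> is_rep \<alpha> H P \<and> irreducible_rep H P"
  then obtain E where "finite E" "orthonormal E" "span E = H"
    using orthonormal_basis_if_discrete_spectrum[OF assms] by blast
  then show "transitive_system (S_F \<alpha> H P)"
    using transitive_system_S_F * by blast
next
  fix \<alpha> \<alpha>' and H :: "'a set" and P :: "'n \<Rightarrow> 'a \<Rightarrow> 'a" and H' :: "'b set" and P' :: "'n \<Rightarrow> 'b \<Rightarrow> 'b"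
  assume *: "\<alpha> \<in> discrete_spectrum CARD('n) - {0} \<and> is_rep \<alpha> H P \<and> irreducible_rep H P \<and>
    \<alpha>' \<in> discrete_spectrum CARD('n) - {0} \<and> is_rep \<alpha>' H' P' \<and> irreducible_rep H' P' \<and>
    \<not> unitarily_equivalent H P H' P'"
  obtain E where "finite E" "orthonormal E" "span E = H"
    using orthonormal_basis_if_discrete_spectrum[OF assms] * by blast
  moreover obtain E' where "finite E'" "orthonormal E'" "span E' = H'"
    using orthonormal_basis_if_discrete_spectrum[OF assms] * by blast
  ultimately show "\<not> S_F \<alpha> H P \<cong>\<^sub>S S_F \<alpha>' H' P'"
    using unitarily_equivalent_if_isomorphic_S_F * by blast
qed

end
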